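(* Let the data $A,b,\sigma,\psi,\phi,\mathcal G_1,\dots,\mathcal G_q$ satisfy the standing assumptions in the context. Fix an outer iteration $k$ with current iterate $x^k$ of the outer algorithm, and let $\{(x^{k,l},u^{k,l},z^{k,l})\}_{l\in\mathbb N}$ be the sequence generated from an arbitrary starting point $(x^{k,0},u^{k,0},z^{k,0})\in\mathbb R^n\times\mathbb R^m\times\mathbb R^m$ by the proximal ADMM described in the context. Then for all sufficiently large $l$ the pair $(x^{k,l},u^{k,l})$ satisfies the three inexactness criteria (C1), (C2), (C3) of the context (with $(\tilde x^{k+1},\tilde u^{k+1})$ replaced by $(x^{k,l},u^{k,l})$).
   Context: **Problem data.** $m\ll n$; $A\in\mathbb R^{m\times n}$ has rows $a_1^T,\dots,a_m^T$; $b\in\mathbb R^m$; $\sigma>0$; $\{\mathcal G_1,\dots,\mathcal G_q\}$ is a partition of $\{1,\dots,n\}$ into disjoint groups; $x_{\mathcal G_i}$ is the subvector of $x\in\mathbb R^n$ indexed by $\mathcal G_i$. $\|\cdot\|$ is the Euclidean norm and $\circ$ is the entrywise product. The problem is $$\min_{x\in\mathbb R^n}\sum_{i=1}^q\psi(\|x_{\mathcal G_i}\|)\quad\text{s.t.}\quad\sum_{i=1}^m\phi\big((a_i^Tx-b_i)^2\big)\le\sigma,\qquad \psi,\phi:\mathbb R_+\to\mathbb R_+ .$$ Let $\mathfrak F$ be its feasible set. **Standing assumptions.** (i) $\psi$ is continuous and strictly concave on $\mathbb R_+$, $\psi(0)=0$, $\lim_{t\to\infty}\psi(t)=\infty$,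 $\psi$ is differentiable on $(0,\infty)$ with $\psi'(t)>0$ there, and $\lim_{t\downarrow0}\psi'(t)$ exists in $(0,\infty)$. (ii) $\phi$ is continuous and concave on $\mathbb R_+$, $\phi(0)=0$, differentiable on $(0,\infty)$ with $\phi'(t)\ge0$ there, and $\lim_{t\downarrow0}\phi'(t)$ exists in $(0,\infty)$. (iii) $A$ has full row rank and $\sigma\in\big(0,\sum_{i=1}^m\phi(b_i^2)\big)$. (iv) There is $x\in\mathbb R^n$ with $\sum_{i=1}^m\phi((a_i^Tx-b_i)^2)=\sigma$, and $\sigma\notin\{j\bar\phi: j=1,\dots,m\}$, where $\bar\phi=\sup_{t\ge0}\phi(t)\in(0,\infty]$. **Notation.** $\psi'_+,\phi'_+$ are right derivatives on $\mathbb R_+$. For $y\in\mathbb R^m_+$, $\Phi(y)=\sum_i\phi(y_i)$ and $\Phi'_+(y)=(\phi'_+(y_i))_i$; for $z\in\mathbb R^q_+$, $\Psi'_+(z)=(\psi'_+(z_i))_i$. $G(x)=x_{\mathcal G}=(\|x_{\mathcal G_1}\|,\dots,\|x_{\mathcal G_q}\|)^T$. For $\omega\in\mathbb R^q_{+}$ with positive entries, $\|\omega\circ G(x)\|_1=\sum_i\omega_i\|x_{\mathcal G_i}\|$, and $\partial(\omega\circ G)(x)=\omega\circ\partial G(x)$ denotes the subdifferential of this function, i.e. the set of $\xi\in\mathbb R^n$ with $\xi_{\mathcal G_i}=\omega_ix_{\mathcal G_i}/\|x_{\mathcal G_i}\|$ if $x_{\mathcal G_i}\ne0$ and $\|\xi_{\mathcal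 G_i}\|\le\omega_i$ if $x_{\mathcal G_i}=0$. $N_U(u)$ is the normal cone to the convex set $U$ at $u$ (empty if $u\notin U$). $A^\dagger$ is the pseudoinverse of $A$. **Bregman distance.** $f:\mathbb R^n\to\mathbb R\cup\{+\infty\}$ is a fixed continuously differentiable (in particular finite-valued) and strictly convex function; $D^f(x,x_0)=f(x)-f(x_0)-\langle\nabla f(x_0),x-x_0\rangle$; for a set $C\subseteq\mathbb R^n$, $D^f(C,x_0)=\inf_{y\in C}D^f(y,x_0)$, with value $\infty$ if $C=\emptyset$. **Outer algorithm.** Let $\{\tau_k\}$ be a positive sequence converging to $0$ and $\{\mu_k\}$ a positive summable sequence; $x^0=A^\dagger b$. Given $x^k$, set $\omega^k_{\mathcal G}=\Psi'_+(x^k_{\mathcal G})$, $y^k=Ax^k-b$, $\upsilon^k=\sqrt{\Phi'_+(y^k\circ y^k)}$ (entrywise), $A_k=\mathrm{Diag}(\upsilon^k)A$, $b^k=\upsilon^k\circ b$, $\sigma_k=\sigma+\|A_kx^k-b^k\|^2-\Phi(y^k\circ y^k)$, $U^k=\{u\in\mathbb R^m:\|u\|^2\le\sigma_k\}$. The subproblem is $$\min_{x,u}\ \|\omega^k_{\mathcal G}\circ G(x)\|_1\quad\text{s.t. } A_kx-u=b^k,\ u\in U^k.$$ Choose $\epsilon_k\in(0,\min\{\sigma_k,\sqrt{\sigma_k},\tau_k\}]$ and find $(\tilde x^{k+1},\tilde u^{k+1})$ satisfying - (C1) $D^f\big(\partial(\omega^k_{\mathcal G}\circ G)(\tilde x^{k+1})+A_k^TN_{U^k}(\tilde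 u^{k+1}),\,0\big)\le\epsilon_k$, - (C2) $\|A_k\tilde x^{k+1}-b^k-\tilde u^{k+1}\|\le\epsilon_k$, - (C3) $\|\omega^k_{\mathcal G}\circ G(P_k(\tilde x^{k+1}))\|_1\le\|\omega^k_{\mathcal G}\circ x^k_{\mathcal G}\|_1+\mu_k$, where $P_k(x)=x$ if $\|A_kx-b^k\|^2\le\sigma_k$, and otherwise $P_k(x)=\Big(1-\frac{\sqrt{\sigma_k}}{\|A_kx-b^k\|}\Big)A^\dagger b+\frac{\sqrt{\sigma_k}}{\|A_kx-b^k\|}x$. Then $x^{k+1}=P_k(\tilde x^{k+1})$. All iterates $x^k$ lie in $\mathfrak F$, and $\sigma_k\in(0,\sigma]$. **Proximal ADMM for the subproblem.** Let $\beta>0$, $r\in\big(0,\tfrac{1+\sqrt5}2\big)$, $\rho=\bar L\beta$ with $\bar L=\max_i\{\phi'_+((a_i^Tx^k-b_i)^2)\}\,\lambda_{\max}(A^TA)$, so that $\rho>0$ and $\rho I-\beta A_k^TA_k\succeq0$. Let $$L_\beta(x,u;z)=\|\omega^k_{\mathcal G}\circ G(x)\|_1+\delta_{U^k}(u)-z^T(A_kx-u-b^k)+\tfrac\beta2\|A_kx-u-b^k\|^2,$$ with $\delta_{U^k}$ the indicator function of $U^k$. For $l=0,1,2,\dots$ (iterating without applying the stopping test): - $x^{k,l+1}\in\operatorname{Arg\,min}_x\{L_\beta(x,u^{k,l};z^{k,l})+\tfrac12(x-x^{k,l})^T(\rho I-\beta A_k^TA_k)(x-x^{k,l})\}$; -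 $u^{k,l+1}=\operatorname{arg\,min}_uL_\beta(x^{k,l+1},u;z^{k,l})$; - $z^{k,l+1}=z^{k,l}-r\beta(A_kx^{k,l+1}-b^k-u^{k,l+1})$. *)

theory Defs
  imports "HOL-Analysis.Analysis" "HOL-Library.Disjoint_Sets"
begin

section \<open>Convex analysis and linear algebra\<close>

definition strictly_convex_on :: "'a::real_vector set \<Rightarrow> ('a \<Rightarrow> real) \<Rightarrow> bool" where
  "strictly_convex_on S f \<longleftrightarrow> convex S \<and>
     (\<forall>x\<in>S. \<forall>y\<in>S. \<forall>u>0. \<forall>v>0. x \<noteq> y \<longrightarrow> u + v = 1 \<longrightarrow>
        f (u *\<^sub>R x + v *\<^sub>R y) < u * f x + v * f y)"

definition strictly_concave_on :: "'a::real_vector set \<Rightarrow> ('a \<Rightarrow> real) \<Rightarrow> bool" where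
  "strictly_concave_on S f \<longleftrightarrow> strictly_convex_on S (\<lambda>x. - f x)"

definition right_deriv :: "(real \<Rightarrow> real) \<Rightarrow> real \<Rightarrow> real" where
  "right_deriv h t = vector_derivative h (at_right t)"

definition grad :: "('a::real_inner \<Rightarrow> real) \<Rightarrow> 'a \<Rightarrow> 'a" where
  "grad f x = (THE D. GDERIV f x :> D)"

definition subdifferential :: "('a::real_inner \<Rightarrow> real) \<Rightarrow> 'a \<Rightarrow> 'a set" where
  "subdifferential h x = {\<xi>. \<forall>y. h x + \<xi> \<bullet> (y - x) \<le> h y}"

definition normal_cone :: "'a::real_inner set \<Rightarrow> 'a \<Rightarrow> 'a set" where
  "normal_cone U u = (if u \<in> U then {v. \<forall>w\<in>U. v \<bullet> (w - u) \<le> 0} else {})"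

definition indicator_fun :: "'a set \<Rightarrow> 'a \<Rightarrow> ereal" where
  "indicator_fun U u = (if u \<in> U then 0 else \<infinity>)"

definition bregman :: "('a::real_inner \<Rightarrow> real) \<Rightarrow> 'a \<Rightarrow> 'a \<Rightarrow> real" where
  "bregman f x x0 = f x - f x0 - grad f x0 \<bullet> (x - x0)"

definition bregman_set :: "('a::real_inner \<Rightarrow> real) \<Rightarrow> 'a set \<Rightarrow> 'a \<Rightarrow> ereal" where
  "bregman_set f C x0 = (INF y\<in>C. ereal (bregman f y x0))"

definition diag :: "real^'m \<Rightarrow> real^'m^'m" where
  "diag v = (\<chi> i j. if i = j then v $ i else 0)"

text \<open>The Moore--Penrose pseudoinverse, characterised by the four Penrose equations.\<close>

definition pinv :: "real^'n^'m \<Rightarrow> real^'m^'n" where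
  "pinv A = (THE X. A ** X ** A = A \<and> X ** A ** X = X \<and>
                    transpose (A ** X) = A ** X \<and> transpose (X ** A) = X ** A)"

text \<open>The largest (real) eigenvalue; only used for symmetric matrices.\<close>

definition lambda_max :: "real^'n^'n \<Rightarrow> real" where
  "lambda_max M = Max {l. \<exists>v. v \<noteq> 0 \<and> M *v v = l *\<^sub>R v}"

section \<open>Group norms\<close>

text \<open>The groups are given by \<open>G :: 'q \<Rightarrow> 'n set\<close>; \<open>group_norms G x\<close> is the vector of the Euclidean
  norms of the subvectors of \<open>x\<close>.\<close>

definition group_norms :: "('q \<Rightarrow> 'n set) \<Rightarrow> real^'n \<Rightarrow> real^'q" where
  "group_norms G x = (\<chi> i. L2_set (\<lambda>j. x $ j) (G i))"

definition weighted_group_norm :: "real^'q \<Rightarrow> ('q \<Rightarrow> 'n set) \<Rightarrow> real^'n \<Rightarrow> real" where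
  "weighted_group_norm w G x = (\<Sum>i\<in>UNIV. w $ i * group_norms G x $ i)"

text \<open>For positive weights and a partition \<open>G\<close>, the subdifferential of the weighted group norm is
  the familiar blockwise set.\<close>

lemma subdifferential_weighted_group_norm:
  fixes w :: "real^'q" and G :: "'q \<Rightarrow> 'n::finite set" and x :: "real^'n"
  assumes part: "partition_on UNIV (range G)" and inj: "inj G" and w: "\<And>i. w $ i > 0"
  shows "subdifferential (weighted_group_norm w G) x =
    {\<xi>. \<forall>i. if group_norms G x $ i = 0 then group_norms G \<xi> $ i \<le> w $ i
             else (\<forall>j\<in>G i. \<xi> $ j = w $ i * x $ j / group_norms G x $ i)}"
proof -
  have disj: "G i \<inter> G i' = {}" if "i \<noteq> i'" for i i'
    using part inj that unfolding partition_on_def disjoint_def by (metis injD rangeI)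
  have un: "(\<Union>i. G i) = UNIV" using part by (simp add: partition_on_def)
  have sum_groups: "(\<Sum>j\<in>UNIV. h j) = (\<Sum>i\<in>UNIV. \<Sum>j\<in>G i. h j)" for h :: "'n \<Rightarrow> real"
    using sum.UNION_disjoint[of UNIV G h] disj by (simp add: un)
  define N where "N y i = L2_set (\<lambda>j. y $ j) (G i)" for y :: "real^'n" and i
  have N_nonneg: "N y i \<ge> 0" for y i by (simp add: N_def)
  have N_sq: "(N y i)\<^sup>2 = (\<Sum>j\<in>G i. (y $ j)\<^sup>2)" for y i
    by (simp add: N_def L2_set_def sum_nonneg)
  have CS: "(\<Sum>j\<in>G i. a $ j * y $ j) \<le> N a i * N y i" for a y :: "real^'n" and i
  proof -
    have "(\<Sum>j\<in>G i. a $ j * y $ j) \<le> (\<Sum>j\<in>G i. \<bar>a $ j\<bar> * \<bar>y $ j\<bar>)"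
      by (intro sum_mono) (metis abs_ge_self abs_mult)
    also have "\<dots> \<le> N a i * N y i" unfolding N_def by (rule L2_set_mult_ineq)
    finally show ?thesis .
  qed
  have N_tri: "N (a + y) i \<le> N a i + N y i" for a y :: "real^'n" and i
    unfolding N_def using L2_set_triangle_ineq[of "\<lambda>j. a $ j" "\<lambda>j. y $ j" "G i"]
    by (simp flip: vector_add_component)
  have h_eq: "weighted_group_norm w G y = (\<Sum>i\<in>UNIV. w $ i * N y i)" for y
    by (simp add: weighted_group_norm_def group_norms_def N_def)
  have inner_eq: "a \<bullet> y = (\<Sum>i\<in>UNIV. \<Sum>j\<in>G i. a $ j * y $ j)" for a y :: "real^'n"
    by (simp add: inner_vec_def sum_groups)
  have local: "\<xi> \<in> subdifferential (weighted_group_norm w G) x \<longleftrightarrow>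
      (\<forall>i d. (\<Sum>j\<in>G i. \<xi> $ j * d $ j) \<le> w $ i * (N (x + d) i - N x i))" (is "?L = ?R") for \<xi>
  proof
    assume L: ?L
    show ?R
    proof (intro allI)
      fix i :: 'q and d :: "real^'n"
      define e :: "real^'n" where "e = (\<chi> j. if j \<in> G i then d $ j else 0)"
      have e_in: "e $ j = d $ j" if "j \<in> G i" for j using that by (simp add: e_def)
      have e_out: "e $ j = 0" if "j \<in> G i'" "i' \<noteq> i" for j i'
        using that disj[of i' i] by (auto simp: e_def)
      have N_in: "N (x + e) i = N (x + d) i"
        unfolding N_def by (rule L2_set_cong) (simp_all add: e_in)
      have N_out: "N (x + e) i' = N x i'" if "i' \<noteq> i" for i'
        unfolding N_def by (rule L2_set_cong) (use that in \<open>simp_all add: e_out\<close>)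
      have "(\<Sum>i'\<in>UNIV. w $ i' * N x i') + \<xi> \<bullet> e \<le> (\<Sum>i'\<in>UNIV. w $ i' * N (x + e) i')"
        using L[unfolded subdifferential_def mem_Collect_eq h_eq, rule_format, of "x + e"] by simp
      then have "\<xi> \<bullet> e \<le> (\<Sum>i'\<in>UNIV. w $ i' * (N (x + e) i' - N x i'))"
        by (simp add: right_diff_distrib sum_subtractf)
      also have "\<dots> = (\<Sum>i'\<in>UNIV. if i' = i then w $ i * (N (x + d) i - N x i) else 0)"
        by (rule sum.cong) (auto simp: N_in N_out)
      also have "\<dots> = w $ i * (N (x + d) i - N x i)" by simp
      finally have "\<xi> \<bullet> e \<le> w $ i * (N (x + d) i - N x i)" .
      moreover have "\<xi> \<bullet> e = (\<Sum>i'\<in>UNIV. if i' = i then \<Sum>j\<in>G i. \<xi> $ j * d $ j else 0)"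
        unfolding inner_eq by (rule sum.cong) (auto simp: e_in e_out intro!: sum.cong sum.neutral)
      ultimately show "(\<Sum>j\<in>G i. \<xi> $ j * d $ j) \<le> w $ i * (N (x + d) i - N x i)" by simp
    qed
  next
    assume R: ?R
    have "(\<Sum>i\<in>UNIV. w $ i * N x i) + \<xi> \<bullet> (y - x) \<le> (\<Sum>i\<in>UNIV. w $ i * N y i)" for y
    proof -
      have "\<xi> \<bullet> (y - x) \<le> (\<Sum>i\<in>UNIV. w $ i * (N (x + (y - x)) i - N x i))"
        unfolding inner_eq by (rule sum_mono) (use R in blast)
      then show ?thesis by (simp add: right_diff_distrib sum_subtractf)
    qed
    then show ?L by (simp add: subdifferential_def h_eq)
  qed
  have block: "(\<forall>d. (\<Sum>j\<in>G i. \<xi> $ j * d $ j) \<le> w $ i * (N (x + d) i - N x i)) \<longleftrightarrow>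
      (if N x i = 0 then N \<xi> i \<le> w $ i else \<forall>j\<in>G i. \<xi> $ j = w $ i * x $ j / N x i)"
    (is "?L = ?R") for \<xi> i
  proof
    assume L: ?L
    have sq: "(\<Sum>j\<in>G i. \<xi> $ j * \<xi> $ j) = (N \<xi> i)\<^sup>2"
      by (simp only: N_sq) (simp add: power2_eq_square)
    have "(N \<xi> i)\<^sup>2 \<le> w $ i * (N (x + \<xi>) i - N x i)" using L sq by metis
    also have "\<dots> \<le> w $ i * N \<xi> i"
      using N_tri[of x \<xi> i] w[of i] by (intro mult_left_mono) auto
    finally have le: "N \<xi> i \<le> w $ i"
      using N_nonneg[of \<xi> i] w[of i] by (cases "N \<xi> i = 0") (auto simp: power2_eq_square)
    show ?R
    proof (cases "N x i = 0")
      case True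
      with le show ?thesis by simp
    next
      case False
      then have pos: "N x i > 0" using N_nonneg[of x i] by simp
      have "N (x + - x) i = 0" by (simp add: N_def L2_set_def)
      then have "w $ i * N x i \<le> (\<Sum>j\<in>G i. \<xi> $ j * x $ j)"
        using L[rule_format, of "- x"] by (simp add: sum_negf)
      then have "w $ i * N x i / N x i \<le> (\<Sum>j\<in>G i. \<xi> $ j * x $ j) / N x i"
        using pos by (intro divide_right_mono) auto
      then have ip: "w $ i \<le> (\<Sum>j\<in>G i. \<xi> $ j * x $ j) / N x i" using pos by simp
      define c where "c = w $ i / N x i"
      have "(\<Sum>j\<in>G i. (\<xi> $ j - c * x $ j)\<^sup>2) =
          (N \<xi> i)\<^sup>2 - 2 * c * (\<Sum>j\<in>G i. \<xi> $ j * x $ j) + c\<^sup>2 * (N x i)\<^sup>2"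
        by (simp add: N_sq power2_diff sum.distrib sum_subtractf sum_distrib_left
            power_mult_distrib algebra_simps)
      also have "2 * c * (\<Sum>j\<in>G i. \<xi> $ j * x $ j) = 2 * w $ i * ((\<Sum>j\<in>G i. \<xi> $ j * x $ j) / N x i)"
        by (simp add: c_def)
      also have "c\<^sup>2 * (N x i)\<^sup>2 = (w $ i)\<^sup>2" using pos by (simp add: c_def power_divide)
      also have "(N \<xi> i)\<^sup>2 - 2 * w $ i * ((\<Sum>j\<in>G i. \<xi> $ j * x $ j) / N x i) + (w $ i)\<^sup>2 \<le> 0"
      proof -
        have "(N \<xi> i)\<^sup>2 \<le> (w $ i)\<^sup>2" using le N_nonneg by (intro power_mono) auto
        moreover have "2 * w $ i * w $ i \<le> 2 * w $ i * ((\<Sum>j\<in>G i. \<xi> $ j * x $ j) / N x i)"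
          using ip w[of i] by (intro mult_left_mono) auto
        ultimately show ?thesis by (simp add: power2_eq_square)
      qed
      finally have "(\<Sum>j\<in>G i. (\<xi> $ j - c * x $ j)\<^sup>2) = 0"
        by (meson order_antisym sum_nonneg zero_le_power2)
      then have "\<forall>j\<in>G i. (\<xi> $ j - c * x $ j)\<^sup>2 = 0"
        by (subst (asm) sum_nonneg_eq_0_iff) auto
      with False show ?thesis by (simp add: c_def)
    qed
  next
    assume R: ?R
    show ?L
    proof
      fix d :: "real^'n"
      show "(\<Sum>j\<in>G i. \<xi> $ j * d $ j) \<le> w $ i * (N (x + d) i - N x i)"
      proof (cases "N x i = 0")
        case True
        then have "\<forall>j\<in>G i. x $ j = 0"
          by (simp add: N_def L2_set_eq_0_iff)
        then have "N (x + d) i = N d i" unfolding N_def by (intro L2_set_cong) auto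
        moreover have "N \<xi> i * N d i \<le> w $ i * N d i"
          using R True N_nonneg by (intro mult_right_mono) auto
        ultimately show ?thesis using CS[of \<xi> d i] True by simp
      next
        case False
        then have pos: "N x i > 0" using N_nonneg[of x i] by simp
        have "(\<Sum>j\<in>G i. \<xi> $ j * d $ j) = (\<Sum>j\<in>G i. w $ i / N x i * (x $ j * d $ j))"
          using R False by (intro sum.cong) auto
        also have "\<dots> = w $ i / N x i * (\<Sum>j\<in>G i. x $ j * (x + d) $ j - (x $ j)\<^sup>2)"
          by (simp add: sum_distrib_left power2_eq_square algebra_simps)
        also have "\<dots> = w $ i / N x i * ((\<Sum>j\<in>G i. x $ j * (x + d) $ j) - (N x i)\<^sup>2)"
          by (simp add: sum_subtractf N_sq)
        also have "\<dots> \<le> w $ i / N x i * (N x i * N (x + d) i - (N x i)\<^sup>2)"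
          using CS[of x "x + d" i] pos w[of i] by (intro mult_left_mono) auto
        also have "\<dots> = w $ i * (N (x + d) i - N x i)"
          using pos by (simp add: power2_eq_square field_simps)
        finally show ?thesis .
      qed
    qed
  qed
  have gn: "group_norms G y $ i = N y i" for y i by (simp add: group_norms_def N_def)
  show ?thesis by (rule set_eqI) (simp only: local block gn mem_Collect_eq)
qed

section \<open>The outer algorithm\<close>

definition Phi :: "(real \<Rightarrow> real) \<Rightarrow> real^'m \<Rightarrow> real" where
  "Phi \<phi> y = (\<Sum>i\<in>UNIV. \<phi> (y $ i))"

text \<open>In the following, \<open>x\<close> is the current outer iterate, at which the weights, the scaling \<open>\<upsilon>\<close>, the
  matrix \<open>A\<^sub>k\<close>, the vector \<open>b\<^sup>k\<close>, the radius \<open>\<sigma>\<^sub>k\<close>, the set \<open>U\<^sup>k\<close> and the map \<open>P\<^sub>k\<close> are formed.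
  Multiplication of vectors is entrywise.\<close>

definition weights :: "(real \<Rightarrow> real) \<Rightarrow> ('q \<Rightarrow> 'n set) \<Rightarrow> real^'n \<Rightarrow> real^'q" where
  "weights \<psi> G x = (\<chi> i. right_deriv \<psi> (group_norms G x $ i))"

definition resid :: "real^'n^'m \<Rightarrow> real^'m \<Rightarrow> real^'n \<Rightarrow> real^'m" where
  "resid A b x = A *v x - b"

definition upsilon :: "(real \<Rightarrow> real) \<Rightarrow> real^'n^'m \<Rightarrow> real^'m \<Rightarrow> real^'n \<Rightarrow> real^'m" where
  "upsilon \<phi> A b x = (\<chi> i. sqrt (right_deriv \<phi> ((resid A b x * resid A b x) $ i)))"

definition lin_A :: "(real \<Rightarrow> real) \<Rightarrow> real^'n^'m \<Rightarrow> real^'m \<Rightarrow> real^'n \<Rightarrow> real^'n^'m" where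
  "lin_A \<phi> A b x = diag (upsilon \<phi> A b x) ** A"

definition lin_b :: "(real \<Rightarrow> real) \<Rightarrow> real^'n^'m \<Rightarrow> real^'m \<Rightarrow> real^'n \<Rightarrow> real^'m" where
  "lin_b \<phi> A b x = upsilon \<phi> A b x * b"

definition lin_sigma ::
  "(real \<Rightarrow> real) \<Rightarrow> real^'n^'m \<Rightarrow> real^'m \<Rightarrow> real \<Rightarrow> real^'n \<Rightarrow> real" where
  "lin_sigma \<phi> A b \<sigma> x = \<sigma> + (norm (lin_A \<phi> A b x *v x - lin_b \<phi> A b x))\<^sup>2
                            - Phi \<phi> (resid A b x * resid A b x)"

definition lin_U ::
  "(real \<Rightarrow> real) \<Rightarrow> real^'n^'m \<Rightarrow> real^'m \<Rightarrow> real \<Rightarrow> real^'n \<Rightarrow> (real^'m) set" where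
  "lin_U \<phi> A b \<sigma> x = {u. (norm u)\<^sup>2 \<le> lin_sigma \<phi> A b \<sigma> x}"

definition lin_P ::
  "(real \<Rightarrow> real) \<Rightarrow> real^'n^'m \<Rightarrow> real^'m \<Rightarrow> real \<Rightarrow> real^'n \<Rightarrow> real^'n \<Rightarrow> real^'n" where
  "lin_P \<phi> A b \<sigma> x v =
     (let s = lin_sigma \<phi> A b \<sigma> x; d = norm (lin_A \<phi> A b x *v v - lin_b \<phi> A b x)
      in if d\<^sup>2 \<le> s then v
         else (1 - sqrt s / d) *\<^sub>R (pinv A *v b) + (sqrt s / d) *\<^sub>R v)"

text \<open>Elements of the set in the first criterion are the sums of a subgradient and an
  \<open>A\<^sub>k\<close>-transposed normal vector; the set is empty, with Bregman distance \<open>\<infinity>\<close>, if \<open>u \<notin> U\<^sup>k\<close>.\<close>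

definition crit1 ::
  "(real^'n \<Rightarrow> real) \<Rightarrow> (real \<Rightarrow> real) \<Rightarrow> ('q::finite \<Rightarrow> 'n set) \<Rightarrow> (real \<Rightarrow> real) \<Rightarrow> real^'n^'m \<Rightarrow> real^'m \<Rightarrow> real \<Rightarrow>
   real^'n \<Rightarrow> real \<Rightarrow> real^'n \<Rightarrow> real^'m \<Rightarrow> bool" where
  "crit1 f \<psi> G \<phi> A b \<sigma> x \<epsilon> xt ut \<longleftrightarrow>
     bregman_set f
       {\<xi> + transpose (lin_A \<phi> A b x) *v v | \<xi> v.
          \<xi> \<in> subdifferential (weighted_group_norm (weights \<psi> G x) G) xt \<and>
          v \<in> normal_cone (lin_U \<phi> A b \<sigma> x) ut} 0 \<le> ereal \<epsilon>"

definition crit2 ::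
  "(real \<Rightarrow> real) \<Rightarrow> real^'n^'m \<Rightarrow> real^'m \<Rightarrow> real^'n \<Rightarrow> real \<Rightarrow>
   real^'n \<Rightarrow> real^'m \<Rightarrow> bool" where
  "crit2 \<phi> A b x \<epsilon> xt ut \<longleftrightarrow> norm (lin_A \<phi> A b x *v xt - lin_b \<phi> A b x - ut) \<le> \<epsilon>"

definition crit3 ::
  "(real \<Rightarrow> real) \<Rightarrow> ('q::finite \<Rightarrow> 'n set) \<Rightarrow> (real \<Rightarrow> real) \<Rightarrow> real^'n^'m \<Rightarrow> real^'m \<Rightarrow> real \<Rightarrow>
   real^'n \<Rightarrow> real \<Rightarrow> real^'n \<Rightarrow> bool" where
  "crit3 \<psi> G \<phi> A b \<sigma> x \<mu> xt \<longleftrightarrow>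
     weighted_group_norm (weights \<psi> G x) G (lin_P \<phi> A b \<sigma> x xt)
       \<le> weighted_group_norm (weights \<psi> G x) G x + \<mu>"

text \<open>The iterates \<open>x 0, \<dots>, x k\<close> have been generated by the outer algorithm from admissible tolerances,
  and \<open>\<epsilon> k\<close> is an admissible tolerance for iteration \<open>k\<close>. Values of the sequences at later indices are
  unconstrained.\<close>

definition outer_run ::
  "(real^'n \<Rightarrow> real) \<Rightarrow> (real \<Rightarrow> real) \<Rightarrow> ('q::finite \<Rightarrow> 'n set) \<Rightarrow> (real \<Rightarrow> real) \<Rightarrow> real^'n^'m \<Rightarrow> real^'m \<Rightarrow>
   real \<Rightarrow> (nat \<Rightarrow> real) \<Rightarrow> (nat \<Rightarrow> real) \<Rightarrow> (nat \<Rightarrow> real) \<Rightarrow>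
   nat \<Rightarrow> (nat \<Rightarrow> real^'n) \<Rightarrow> (nat \<Rightarrow> real^'n) \<Rightarrow> (nat \<Rightarrow> real^'m) \<Rightarrow> bool" where
  "outer_run f \<psi> G \<phi> A b \<sigma> \<tau> \<mu> \<epsilon> k x xt ut \<longleftrightarrow>
     x 0 = pinv A *v b \<and>
     (\<forall>j\<le>k. 0 < \<epsilon> j \<and>
        \<epsilon> j \<le> Min {lin_sigma \<phi> A b \<sigma> (x j), sqrt (lin_sigma \<phi> A b \<sigma> (x j)), \<tau> j}) \<and>
     (\<forall>j<k. crit1 f \<psi> G \<phi> A b \<sigma> (x j) (\<epsilon> j) (xt (Suc j)) (ut (Suc j)) \<and>
             crit2 \<phi> A b (x j) (\<epsilon> j) (xt (Suc j)) (ut (Suc j)) \<and>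
             crit3 \<psi> G \<phi> A b \<sigma> (x j) (\<mu> j) (xt (Suc j)) \<and>
             x (Suc j) = lin_P \<phi> A b \<sigma> (x j) (xt (Suc j)))"

section \<open>The proximal ADMM for the subproblem\<close>

definition aug_lagrangian ::
  "(real \<Rightarrow> real) \<Rightarrow> ('q::finite \<Rightarrow> 'n set) \<Rightarrow> (real \<Rightarrow> real) \<Rightarrow> real^'n^'m \<Rightarrow> real^'m \<Rightarrow> real \<Rightarrow> real^'n \<Rightarrow>
   real \<Rightarrow> real^'n \<Rightarrow> real^'m \<Rightarrow> real^'m \<Rightarrow> ereal" where
  "aug_lagrangian \<psi> G \<phi> A b \<sigma> x \<beta> v u z =
     (let r = lin_A \<phi> A b x *v v - u - lin_b \<phi> A b x
      in ereal (weighted_group_norm (weights \<psi> G x) G v) + indicator_fun (lin_U \<phi> A b \<sigma> x) u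
         + ereal (- (z \<bullet> r) + \<beta> / 2 * (norm r)\<^sup>2))"

definition prox_rho ::
  "(real \<Rightarrow> real) \<Rightarrow> real^'n^'m \<Rightarrow> real^'m \<Rightarrow> real^'n \<Rightarrow> real \<Rightarrow> real" where
  "prox_rho \<phi> A b x \<beta> =
     Max (range (\<lambda>i. right_deriv \<phi> ((resid A b x $ i)\<^sup>2))) * lambda_max (transpose A ** A) * \<beta>"

definition prox_matrix ::
  "(real \<Rightarrow> real) \<Rightarrow> real^'n^'m \<Rightarrow> real^'m \<Rightarrow> real^'n \<Rightarrow> real \<Rightarrow> real^'n^'n" where
  "prox_matrix \<phi> A b x \<beta> =
     prox_rho \<phi> A b x \<beta> *\<^sub>R mat 1 - \<beta> *\<^sub>R (transpose (lin_A \<phi> A b x) ** lin_A \<phi> A b x)"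

text \<open>The starting point is arbitrary. If \<open>U 0 \<notin> U\<^sup>k\<close>, the objective of the first \<open>x\<close>-step is
  constantly \<open>\<infinity>\<close>, so that every vector is an admissible \<open>X 1\<close>.\<close>

definition prox_admm ::
  "(real \<Rightarrow> real) \<Rightarrow> ('q::finite \<Rightarrow> 'n set) \<Rightarrow> (real \<Rightarrow> real) \<Rightarrow> real^'n^'m \<Rightarrow> real^'m \<Rightarrow> real \<Rightarrow> real^'n \<Rightarrow>
   real \<Rightarrow> real \<Rightarrow> (nat \<Rightarrow> real^'n) \<Rightarrow> (nat \<Rightarrow> real^'m) \<Rightarrow> (nat \<Rightarrow> real^'m) \<Rightarrow> bool" where
  "prox_admm \<psi> G \<phi> A b \<sigma> x \<beta> r X U Z \<longleftrightarrow>
     (\<forall>l. is_arg_min (\<lambda>v. aug_lagrangian \<psi> G \<phi> A b \<sigma> x \<beta> v (U l) (Z l)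
               + ereal (1/2 * ((v - X l) \<bullet> (prox_matrix \<phi> A b x \<beta> *v (v - X l)))))
             (\<lambda>_. True) (X (Suc l)) \<and>
          is_arg_min (\<lambda>u. aug_lagrangian \<psi> G \<phi> A b \<sigma> x \<beta> (X (Suc l)) u (Z l))
             (\<lambda>_. True) (U (Suc l)) \<and>
          Z (Suc l) = Z l - (r * \<beta>) *\<^sub>R
             (lin_A \<phi> A b x *v X (Suc l) - lin_b \<phi> A b x - U (Suc l)))"

end

theory Submission
  imports Defs
begin

text \<open>Slater's condition holds for the subproblem at \<open>A\<^sup>\<dagger>b\<close>, so it has a saddle point.
  Measured from it, \<open>\<parallel>z\<parallel>\<^sup>2 / (r\<beta>) + \<beta>\<parallel>u\<parallel>\<^sup>2 + \<parallel>x\<parallel>\<^sub>T\<^sup>2\<close>, with \<open>T\<close> the proximal matrix, plus a multiple of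
  the squared residual decreases along the proximal ADMM whenever \<open>r\<close> is below the golden ratio. Hence
  the iterates are bounded, and residuals and increments tend to zero. The optimality conditions of the
  two steps exhibit an element of the set in the first criterion that depends linearly on the increments;
  it tends to zero, and so does its Bregman distance to zero. The same element and the residual bound the
  gap to the optimal value, and \<open>P\<^sub>k\<close> raises the objective by at most a multiple of the residual. Since
  \<open>x\<^sup>k\<close> is feasible for the subproblem, this yields the third criterion; convergence of the iterates
  themselves is not needed.\<close>

section \<open>Linear algebra: the pseudoinverse at full row rank and the largest eigenvalue\<close>

lemma inner_transpose_mult:
  fixes A :: "real^'n^'m"
  shows "(transpose A *v y) \<bullet> x = y \<bullet> (A *v x)"
  by (simp add: dot_lmul_matrix)

text \<open>Since \<open>pinv\<close> is a definite description, the Penrose equations must first be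
  shown to have exactly one solution. Full row rank makes \<open>A ** transpose A\<close>
  invertible; with \<open>V\<close> its inverse, the solution is \<open>transpose A ** V\<close>.
  For any solution, \<open>A ** X ** A = A\<close> and surjectivity of \<open>A\<close> force
  \<open>A ** X = mat 1\<close>.\<close>

lemma pinv_right_inverse:
  fixes A :: "real^'n^'m"
  assumes "rank A = CARD('m)"
  shows "A *v (pinv A *v b) = b"
proof -
  define P where "P X \<longleftrightarrow> A ** X ** A = A \<and> X ** A ** X = X \<and>
    transpose (A ** X) = A ** X \<and> transpose (X ** A) = X ** A" for X
  have surj: "surj ((*v) A)" using assms full_rank_surjective by blast
  have "inj ((*v) (A ** transpose A))"
  proof (subst linear_injective_0)
    show "\<forall>y. (A ** transpose A) *v y = 0 \<longrightarrow> y = 0"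
    proof (intro allI impI)
      fix y assume y: "(A ** transpose A) *v y = 0"
      have "(transpose A *v y) \<bullet> (transpose A *v y) = y \<bullet> ((A ** transpose A) *v y)"
        by (simp only: inner_transpose_mult matrix_vector_mul_assoc)
      then have "transpose A *v y = 0" using y by simp
      moreover obtain c where "y = A *v c" using surj by (metis surjD)
      ultimately have "y \<bullet> y = 0" using inner_transpose_mult[of A y c] by simp
      then show "y = 0" by simp
    qed
  qed simp
  then obtain V where VA: "V ** (A ** transpose A) = mat 1"
    using matrix_left_invertible_injective by blast
  then have AV: "A ** transpose A ** V = mat 1"
    using matrix_left_right_inverse by blast
  have "transpose (V ** (A ** transpose A)) = mat 1" by (simp add: VA)
  then have "A ** transpose A ** transpose V = mat 1"
    by (simp add: matrix_transpose_mul transpose_transpose)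
  then have V_sym: "transpose V = V"
    using VA by (metis AV matrix_mul_assoc matrix_mul_lid)
  have AX: "A ** X = mat 1" if "P X" for X
  proof -
    have "(A ** X) *v y = y" for y
    proof -
      obtain c where "y = A *v c" using surj by (metis surjD)
      with that show ?thesis by (simp add: P_def matrix_vector_mul_assoc)
    qed
    then show ?thesis by (simp add: matrix_eq)
  qed
  have ex: "P (transpose A ** V)"
    unfolding P_def using AV V_sym
    by (simp add: matrix_mul_assoc matrix_transpose_mul transpose_transpose transpose_mat)
       (metis matrix_mul_assoc matrix_mul_rid)
  \<comment> \<open>\<open>X = X ** A ** X\<close> together with the symmetry of
    \<open>X ** A\<close> puts \<open>X\<close> into the form
    \<open>transpose A ** (transpose X ** X)\<close>. Multiplying by \<open>A\<close> identifies the
    second factor as the inverse \<open>V\<close>.\<close>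
  have uniq: "X = transpose A ** V" if X: "P X" for X
  proof -
    have "X = transpose A ** (transpose X ** X)"
      using X by (metis P_def matrix_mul_assoc matrix_transpose_mul)
    moreover from this have "transpose X ** X = V"
      using AX[OF X] VA by (metis matrix_mul_assoc matrix_mul_lid matrix_mul_rid)
    ultimately show ?thesis by simp
  qed
  have "pinv A = (THE X. P X)" by (simp add: pinv_def P_def)
  also have "P (THE X. P X)" using ex uniq by (rule theI)
  then have "A ** (THE X. P X) = mat 1" by (rule AX)
  finally show ?thesis by (simp add: matrix_vector_mul_assoc)
qed

text \<open>The quadratic form attains its maximum over the unit sphere at an eigenvector, so this
  maximum is among the eigenvalues. The \<open>Max\<close> in \<open>lambda_max\<close> is
  meaningful because eigenvectors of a symmetric matrix for distinct eigenvalues are orthogonal, so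
  there are only finitely many eigenvalues.\<close>

lemma lambda_max_rayleigh:
  fixes M :: "real^'n^'n"
  assumes sym: "transpose M = M"
  shows "v \<bullet> (M *v v) \<le> lambda_max M * (v \<bullet> v)"
proof -
  define E where "E = {l. \<exists>v. v \<noteq> 0 \<and> M *v v = l *\<^sub>R v}"
  have M_sym: "x \<bullet> (M *v y) = (M *v x) \<bullet> y" for x y
    using inner_transpose_mult[of M x y] sym by simp
  have "finite E"
  proof -
    obtain e where e: "\<And>l. l \<in> E \<Longrightarrow> e l \<noteq> 0 \<and> M *v e l = l *\<^sub>R e l"
      unfolding E_def using bchoice[of E "\<lambda>l v. v \<noteq> 0 \<and> M *v v = l *\<^sub>R v"] E_def by auto
    have orth: "e l \<bullet> e l' = 0" if "l \<in> E" "l' \<in> E" "l \<noteq> l'" for l l'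
      using M_sym[of "e l" "e l'"] e that by auto
    have "inj_on e E"
      by (rule inj_onI) (metis e inner_eq_zero_iff orth)
    moreover have "pairwise orthogonal (e ` E)"
      unfolding pairwise_def orthogonal_def using orth by blast
    then have "finite (e ` E)" by (rule pairwise_orthogonal_imp_finite)
    ultimately show ?thesis by (rule finite_imageD[rotated])
  qed
  have cont: "continuous_on S (\<lambda>v. v \<bullet> (M *v v))" for S
    by (intro continuous_intros linear_continuous_on_compose[OF continuous_on_id]) simp
  obtain e where e: "norm e = 1" "\<And>v. norm v = 1 \<Longrightarrow> v \<bullet> (M *v v) \<le> e \<bullet> (M *v e)"
  proof -
    obtain u :: "real^'n" where "norm u = 1" using vector_choose_size[of 1] by auto
    then have "sphere 0 1 \<noteq> ({} :: (real^'n) set)" by auto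
    from continuous_attains_sup[OF compact_sphere this cont] that show thesis by auto
  qed
  define l where "l = e \<bullet> (M *v e)"
  have bound: "v \<bullet> (M *v v) \<le> l * (v \<bullet> v)" for v
  proof (cases "v = 0")
    case False
    then have "(v /\<^sub>R norm v) \<bullet> (M *v (v /\<^sub>R norm v)) \<le> l"
      unfolding l_def by (intro e(2)) simp
    then show ?thesis using False
      by (simp add: matrix_vector_mult_scaleR dot_square_norm power2_eq_square field_simps)
  qed simp
  have "M *v e = l *\<^sub>R e"
  proof -
    \<comment> \<open>The defect of the eigenvalue equation. Testing the bound at
      \<open>e + t *\<^sub>R g\<close> gives a quadratic in \<open>t\<close> whose linear
      coefficient is a negative multiple of \<open>g \<bullet> g\<close>.\<close>
    define g where "g = M *v e - l *\<^sub>R e"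
    have "0 \<le> t * (- 2 * (g \<bullet> g)) + t\<^sup>2 * (l * (g \<bullet> g) - g \<bullet> (M *v g))" for t
    proof -
      have "(e + t *\<^sub>R g) \<bullet> (M *v (e + t *\<^sub>R g)) \<le> l * ((e + t *\<^sub>R g) \<bullet> (e + t *\<^sub>R g))"
        by (rule bound)
      moreover have "(M *v e) \<bullet> g = g \<bullet> g + l * (e \<bullet> g)"
        by (simp add: g_def inner_diff inner_commute algebra_simps)
      moreover have "e \<bullet> (M *v g) = (M *v e) \<bullet> g" by (rule M_sym)
      moreover have "e \<bullet> e = 1" using e(1) by (simp add: dot_square_norm)
      ultimately show ?thesis
        by (simp add: matrix_vector_right_distrib matrix_vector_mult_scaleR inner_add
            inner_commute[of g "M *v e"] inner_commute[of g e] l_def[symmetric] power2_eq_square algebra_simps)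
    qed
    note q = this
    have "g \<bullet> g \<le> 0"
    proof (rule ccontr)
      assume "\<not> g \<bullet> g \<le> 0"
      then have pos: "g \<bullet> g > 0" by linarith
      \<comment> \<open>\<open>c\<close> exceeds the quadratic coefficient, and \<open>t\<close> is
        chosen so that the quadratic term is at most half the size of the negative linear
        term.\<close>
      define c where "c = \<bar>l * (g \<bullet> g) - g \<bullet> (M *v g)\<bar> + 1"
      define t where "t = (g \<bullet> g) / c"
      have "c > 0" unfolding c_def by simp
      then have "t > 0" using pos by (simp add: t_def)
      have "t\<^sup>2 * (l * (g \<bullet> g) - g \<bullet> (M *v g)) \<le> t\<^sup>2 * c"
        by (intro mult_left_mono) (auto simp: c_def)
      also have "\<dots> = t * (g \<bullet> g)" using \<open>c > 0\<close> by (simp add: t_def power2_eq_square)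
      finally have "0 \<le> - (t * (g \<bullet> g))" using q[of t] by simp
      moreover have "0 < t * (g \<bullet> g)" using \<open>t > 0\<close> pos by (rule mult_pos_pos)
      ultimately show False by linarith
    qed
    then show ?thesis by (metis g_def inner_ge_zero inner_eq_zero_iff order_antisym eq_iff_diff_eq_0)
  qed
  moreover have "e \<noteq> 0" using e(1) by auto
  ultimately have "l \<in> E" unfolding E_def by blast
  then have "l \<le> lambda_max M"
    using \<open>finite E\<close> by (simp add: lambda_max_def E_def[symmetric])
  then have "l * (v \<bullet> v) \<le> lambda_max M * (v \<bullet> v)"
    by (intro mult_right_mono) simp_all
  then show ?thesis using bound[of v] by linarith
qed

section \<open>Right derivatives and tangent bounds for concave functions\<close>

lemma right_deriv_at_pos:
  assumes "t > 0" and "h differentiable (at t)"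
  shows "right_deriv h t = deriv h t"
    and "(h has_real_derivative right_deriv h t) (at_right t)"
proof -
  have d: "(h has_real_derivative deriv h t) (at t)"
    using assms(2) by (simp add: DERIV_deriv_iff_real_differentiable)
  then have "(h has_real_derivative deriv h t) (at_right t)"
    by (rule has_field_derivative_at_within)
  then show "right_deriv h t = deriv h t"
    unfolding right_deriv_def
    by (intro vector_derivative_within) (auto simp: has_real_derivative_iff_has_vector_derivative)
  then show "(h has_real_derivative right_deriv h t) (at_right t)"
    by (simp add: d has_field_derivative_at_within)
qed

text \<open>L'Hopital's rule turns the limit of the derivative into a right derivative at the
  endpoint. This is the case met at vanishing groups and at zero residuals.\<close>

lemma right_deriv_at_0:
  assumes cont: "continuous_on {0..} h" and h0: "h 0 = 0"
    and diff: "\<And>t. t > 0 \<Longrightarrow> h differentiable (at t)"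
    and lim: "(deriv h \<longlongrightarrow> L) (at_right 0)"
  shows "right_deriv h 0 = L" and "(h has_real_derivative right_deriv h 0) (at_right 0)"
proof -
  have "((\<lambda>t. h t / t) \<longlongrightarrow> L) (at_right 0)"
  proof (rule lhopital_right_0[where f' = "deriv h" and g' = "\<lambda>_. 1"])
    have "(h \<longlongrightarrow> h 0) (at 0 within {0..})" using cont by (simp add: continuous_on_def)
    then show "(h \<longlongrightarrow> 0) (at_right 0)"
      unfolding h0 by (rule tendsto_within_subset) auto
    show "\<forall>\<^sub>F t in at_right 0. (h has_real_derivative deriv h t) (at t)"
      using diff by (auto simp: eventually_at_filter DERIV_deriv_iff_real_differentiable)
    show "\<forall>\<^sub>F t::real in at_right 0. t \<noteq> 0" by (simp add: eventually_at_filter)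
  qed (use lim in \<open>auto intro!: tendsto_eq_intros\<close>)
  then have d: "(h has_real_derivative L) (at_right 0)"
    by (simp add: has_field_derivative_iff h0)
  then show "right_deriv h 0 = L"
    unfolding right_deriv_def
    by (intro vector_derivative_within) (auto simp: has_real_derivative_iff_has_vector_derivative)
  with d show "(h has_real_derivative right_deriv h 0) (at_right 0)" by simp
qed

text \<open>Secant slopes starting at \<open>t\<close> decrease as the other endpoint moves right.
  The slope to \<open>s\<close> is therefore a lower bound for the slopes to all closer points, and
  hence for their limit \<open>D\<close>.\<close>

lemma concave_le_tangent_at_right:
  assumes conc: "concave_on {a..} h" and t: "a \<le> t" "t < s"
    and d: "(h has_real_derivative D) (at_right t)"
  shows "h s \<le> h t + D * (s - t)"
proof -
  have ev: "\<forall>\<^sub>F v in at_right t. (h s - h t) / (s - t) \<le> (h v - h t) / (v - t)"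
    unfolding eventually_at_right_field
  proof (intro exI[of _ s] conjI allI impI)
    fix v assume v: "t < v" "v < s"
    define c where "c = (v - t) / (s - t)"
    have c: "0 \<le> c" "c \<le> 1" using v by (auto simp: c_def)
    have "(1 - c) * h t + c * h s \<le> h ((1 - c) *\<^sub>R t + c *\<^sub>R s)"
      using concave_onD[OF conc c, of t s] t by simp
    also have "(1 - c) *\<^sub>R t + c *\<^sub>R s = t + c * (s - t)" by (simp add: algebra_simps)
    also have "\<dots> = v" using v by (simp add: c_def)
    finally have "c * (h s - h t) \<le> h v - h t" by (simp add: algebra_simps)
    then have "(h s - h t) / (s - t) * (v - t) \<le> h v - h t" by (simp add: c_def mult.commute)
    then show "(h s - h t) / (s - t) \<le> (h v - h t) / (v - t)"
      using v by (simp add: pos_le_divide_eq)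
  qed (use t in auto)
  have "((\<lambda>v. (h v - h t) / (v - t)) \<longlongrightarrow> D) (at_right t)"
    using d by (simp add: has_field_derivative_iff)
  from tendsto_lowerbound[OF this ev] have "(h s - h t) / (s - t) \<le> D" by simp
  then show ?thesis using t by (simp add: pos_divide_le_eq)
qed

text \<open>To the right of \<open>t\<close> the one-sided bound applies, including at
  \<open>t = 0\<close>. A point to the left forces \<open>t > 0\<close>, where the two-sided
  derivative exists and agrees with the right one.\<close>

lemma concave_le_tangent:
  assumes conc: "concave_on {0..} h" and "continuous_on {0..} h" and "h 0 = 0"
    and diff: "\<And>t. t > 0 \<Longrightarrow> h differentiable (at t)"
    and "(deriv h \<longlongrightarrow> L) (at_right 0)" and "0 \<le> s" "0 \<le> t"
  shows "h s \<le> h t + right_deriv h t * (s - t)"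
proof (rule linorder_cases[of s t])
  assume "t < s"
  have "(h has_real_derivative right_deriv h t) (at_right t)"
  proof (cases "t = 0")
    case True
    then show ?thesis using right_deriv_at_0(2)[OF assms(2,3) diff assms(5)] by simp
  next
    case False
    then have "t > 0" using \<open>0 \<le> t\<close> by simp
    then show ?thesis using diff by (intro right_deriv_at_pos(2))
  qed
  from concave_le_tangent_at_right[OF conc \<open>0 \<le> t\<close> \<open>t < s\<close> this] show ?thesis .
next
  assume "s < t"
  then have "t > 0" using \<open>0 \<le> s\<close> by simp
  have "- deriv h t * (s - t) \<le> - h s - (- h t)"
  proof (rule convex_on_imp_above_tangent[where A = "{0..}" and f = "\<lambda>t. - h t" and c = t and x = s])
    show "convex_on {0..} (\<lambda>t. - h t)" using conc by (simp add: concave_on_def)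
    show "t \<in> interior {0..}" using \<open>t > 0\<close> by simp
    show "((\<lambda>t. - h t) has_real_derivative - deriv h t) (at t within {0..})"
      using diff[OF \<open>t > 0\<close>]
      by (auto simp: DERIV_deriv_iff_real_differentiable
          intro: DERIV_minus[OF has_field_derivative_at_within])
    show "connected {0::real..}" by (rule connected_Ici)
    show "s \<in> {0..}" using \<open>0 \<le> s\<close> by simp
  qed
  moreover have "right_deriv h t = deriv h t"
    using \<open>t > 0\<close> diff[OF \<open>t > 0\<close>] by (rule right_deriv_at_pos)
  ultimately show ?thesis by simp
qed simp

section \<open>First-order conditions and Lagrange multipliers in convex optimization\<close>

lemma nonneg_if_quadratic_nonneg:
  fixes a c :: real
  assumes "\<And>t. 0 < t \<Longrightarrow> t \<le> 1 \<Longrightarrow> 0 \<le> t * a + t\<^sup>2 * c"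
  shows "0 \<le> a"
proof -
  have "\<forall>\<^sub>F t in at_right 0. 0 \<le> a + t * c"
    unfolding eventually_at_right_field
  proof (intro exI[of _ 1] conjI allI impI)
    fix t :: real assume "0 < t" "t < 1"
    then have "0 \<le> t * (a + t * c)"
      using assms[of t] by (simp add: power2_eq_square algebra_simps)
    then show "0 \<le> a + t * c" using \<open>0 < t\<close> by (simp add: zero_le_mult_iff)
  qed simp
  moreover have "((\<lambda>t. a + t * c) \<longlongrightarrow> a + 0 * c) (at_right 0)"
    by (intro tendsto_intros)
  ultimately have "0 \<le> a + 0 * c"
    by (intro tendsto_lowerbound[of "\<lambda>t. a + t * c" "a + 0 * c" "at_right 0"]) simp_all
  then show ?thesis by simp
qed

text \<open>A hyperplane separates 0 from the convex set of pairs of constraint defect and excess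
  value. Slater's condition at \<open>p\<close> (defect 0 with \<open>u = 0\<close> interior to
  \<open>S\<close>) makes the hyperplane non-vertical, so its normal can be scaled into a
  multiplier.\<close>

lemma convex_lagrange_multiplier:
  fixes B :: "real^'n^'m" and h :: "real^'n \<Rightarrow> real"
  assumes h: "convex_on UNIV h" and S: "convex S" "0 \<in> interior S"
    and p: "B *v p = d" and feas: "u0 \<in> S" "B *v x0 - u0 = d"
    and opt: "\<And>y u. u \<in> S \<Longrightarrow> B *v y - u = d \<Longrightarrow> h x0 \<le> h y"
  obtains z where "transpose B *v z \<in> subdifferential h x0" "- z \<in> normal_cone S u0"
proof -
  \<comment> \<open>The strict inequality on \<open>t\<close> is what keeps 0 outside
    \<open>C\<close>: a zero defect with \<open>t = 0\<close> would be a feasible point better than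
    \<open>x0\<close>.\<close>
  define C where "C = {(B *v y - u - d, t) | y u t. u \<in> S \<and> h y - h x0 < t}"
  have "convex C"
  proof (rule convexI)
    fix P Q and a c :: real
    assume "P \<in> C" "Q \<in> C" and ac: "0 \<le> a" "0 \<le> c" "a + c = 1"
    then obtain y1 u1 t1 y2 u2 t2
      where P: "P = (B *v y1 - u1 - d, t1)" "u1 \<in> S" "h y1 - h x0 < t1"
        and Q: "Q = (B *v y2 - u2 - d, t2)" "u2 \<in> S" "h y2 - h x0 < t2"
      unfolding C_def by blast
    have "h (a *\<^sub>R y1 + c *\<^sub>R y2) \<le> a * h y1 + c * h y2"
      using h ac by (simp add: convex_on_def)
    moreover have "a * (h y1 - h x0 - t1) + c * (h y2 - h x0 - t2) < 0"
    proof -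
      have le: "a * (h y1 - h x0 - t1) \<le> 0" "c * (h y2 - h x0 - t2) \<le> 0"
        using ac P(3) Q(3) by (auto intro!: mult_nonneg_nonpos)
      show ?thesis
      proof (cases "a > 0")
        case True
        then have "a * (h y1 - h x0 - t1) < 0" using P(3) by (simp add: mult_pos_neg)
        then show ?thesis using le by linarith
      next
        case False
        then have "c > 0" using ac by simp
        then have "c * (h y2 - h x0 - t2) < 0" using Q(3) by (simp add: mult_pos_neg)
        then show ?thesis using le by linarith
      qed
    qed
    moreover have "a * h x0 + c * h x0 = h x0" using ac by (metis distrib_right mult_1)
    ultimately have "h (a *\<^sub>R y1 + c *\<^sub>R y2) - h x0 < a * t1 + c * t2"
      by (simp add: algebra_simps)
    moreover have "a *\<^sub>R d + c *\<^sub>R d = d" using ac by (metis scaleR_left_distrib scaleR_one)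
    then have "a *\<^sub>R (B *v y1 - u1 - d) + c *\<^sub>R (B *v y2 - u2 - d)
        = B *v (a *\<^sub>R y1 + c *\<^sub>R y2) - (a *\<^sub>R u1 + c *\<^sub>R u2) - d"
      by (simp add: matrix_vector_right_distrib matrix_vector_mult_scaleR algebra_simps)
    moreover have "a *\<^sub>R u1 + c *\<^sub>R u2 \<in> S" using convexD[OF S(1)] P Q ac by blast
    ultimately show "a *\<^sub>R P + c *\<^sub>R Q \<in> C"
      unfolding C_def P Q mem_Collect_eq scaleR_Pair add_Pair real_scaleR_def by blast
  qed
  moreover have "0 \<notin> C"
    using opt unfolding C_def by (force simp: zero_prod_def)
  ultimately obtain \<zeta> \<eta> where nz: "(\<zeta>, \<eta>) \<noteq> 0"
    and sep: "\<And>y u t. u \<in> S \<Longrightarrow> h y - h x0 < t \<Longrightarrow> 0 \<le> \<zeta> \<bullet> (B *v y - u - d) + \<eta> * t"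
  proof -
    obtain q where "q \<noteq> 0" "\<forall>w\<in>C. 0 \<le> q \<bullet> w"
      using separating_hyperplane_set_0[OF \<open>convex C\<close> \<open>0 \<notin> C\<close>] by blast
    then show thesis
      by (intro that[of "fst q" "snd q"]) (auto simp: C_def inner_prod_def)
  qed
  have "0 \<in> S" using S(2) interior_subset by blast
  \<comment> \<open>At \<open>y = p\<close>, \<open>u = 0\<close> the defect vanishes, so
    \<open>\<eta>\<close> is nonnegative. If it were 0, \<open>\<zeta>\<close> would be nonzero, and
    a step from 0 in direction \<open>\<zeta>\<close> that stays inside \<open>S\<close> would
    violate the separation.\<close>
  have \<eta>: "\<eta> > 0"
  proof (rule ccontr)
    assume "\<not> \<eta> > 0"
    obtain e where e: "e > 0" "cball 0 e \<subseteq> S"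
      using S(2) by (auto simp: mem_interior_cball)
    define t where "t = \<bar>h p - h x0\<bar> + 1"
    have t: "h p - h x0 < t" "t > 0" by (auto simp: t_def)
    have "0 \<le> \<eta> * t" using sep[OF \<open>0 \<in> S\<close> t(1)] p by simp
    with t \<open>\<not> \<eta> > 0\<close> have "\<eta> = 0" by (simp add: zero_le_mult_iff)
    with nz have "\<zeta> \<noteq> 0" by (simp add: zero_prod_def)
    define u where "u = (e / norm \<zeta>) *\<^sub>R \<zeta>"
    have "u \<in> S" using e \<open>\<zeta> \<noteq> 0\<close> by (intro subsetD[OF e(2)]) (simp add: u_def)
    then have "0 \<le> \<zeta> \<bullet> (- u)" using sep[OF _ t(1), of u] p \<open>\<eta> = 0\<close> by simp
    moreover have "\<zeta> \<bullet> u > 0" using e \<open>\<zeta> \<noteq> 0\<close> by (simp add: u_def)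
    ultimately show False by simp
  qed
  \<comment> \<open>The excess \<open>t\<close> is pushed down to its excluded limit
    \<open>h y - h x0\<close>.\<close>
  have key: "0 \<le> (\<zeta> /\<^sub>R \<eta>) \<bullet> (B *v y - u - d) + (h y - h x0)" if "u \<in> S" for y u
  proof (rule field_le_epsilon)
    fix e :: real assume "e > 0"
    then have "0 \<le> \<zeta> \<bullet> (B *v y - u - d) + \<eta> * (h y - h x0 + e)"
      by (intro sep that) simp
    then have "0 \<le> (\<zeta> \<bullet> (B *v y - u - d) + \<eta> * (h y - h x0 + e)) / \<eta>"
      using \<eta> by simp
    then show "0 \<le> (\<zeta> /\<^sub>R \<eta>) \<bullet> (B *v y - u - d) + (h y - h x0) + e"
      using \<eta> by (simp add: field_simps)
  qed
  \<comment> \<open>Fixing \<open>u = u0\<close> in \<open>key\<close> gives the subgradient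
    inequality, and fixing \<open>y = x0\<close> gives the normal cone inequality.\<close>
  define z where "z = - (\<zeta> /\<^sub>R \<eta>)"
  have "h x0 + (transpose B *v z) \<bullet> (y - x0) \<le> h y" for y
  proof -
    have "(transpose B *v z) \<bullet> (y - x0) = z \<bullet> (B *v y - u0 - d)"
      unfolding inner_transpose_mult using feas(2) by (simp add: matrix_vector_mult_diff_distrib algebra_simps)
    then show ?thesis using key[OF feas(1), of y] by (simp add: z_def)
  qed
  moreover have "- z \<bullet> (w - u0) \<le> 0" if "w \<in> S" for w
  proof -
    have "B *v x0 - w - d = u0 - w" using feas(2) by (simp add: algebra_simps)
    then have "0 \<le> (\<zeta> /\<^sub>R \<eta>) \<bullet> (u0 - w)" using key[OF that, of x0] by (simp only: diff_self add_0_right)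
    then show ?thesis by (simp add: z_def inner_diff_right)
  qed
  ultimately show thesis
    using feas(1) by (intro that[of z]) (auto simp: subdifferential_def normal_cone_def)
qed

section \<open>Monotonicity and the merit function of the proximal ADMM\<close>

lemma normal_cone_monotone:
  assumes "v1 \<in> normal_cone S u1" "v2 \<in> normal_cone S u2"
  shows "0 \<le> (v1 - v2) \<bullet> (u1 - u2)"
proof -
  have "v1 \<bullet> (u2 - u1) \<le> 0" "v2 \<bullet> (u1 - u2) \<le> 0"
    using assms by (auto simp: normal_cone_def split: if_splits)
  then show ?thesis by (simp add: inner_diff algebra_simps)
qed

lemma subdifferential_monotone:
  assumes "\<xi>1 \<in> subdifferential h x1" "\<xi>2 \<in> subdifferential h x2"
  shows "0 \<le> (\<xi>1 - \<xi>2) \<bullet> (x1 - x2)"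
proof -
  have "h x1 + \<xi>1 \<bullet> (x2 - x1) \<le> h x2" "h x2 + \<xi>2 \<bullet> (x1 - x2) \<le> h x1"
    using assms by (auto simp: subdifferential_def)
  then show ?thesis by (simp add: inner_diff algebra_simps)
qed

text \<open>\<open>c\<close> is the weight for Young's inequality on the cross term of the merit
  function; the two bounds keep the coefficients of the squared increment and of the squared
  residual positive. For \<open>r > 1\<close> the choice \<open>c = r\<close> turns both into
  \<open>r\<^sup>2 < r + 1\<close>, which is where the golden ratio enters.\<close>

lemma golden_ratio_weight:
  fixes r :: real
  assumes "0 < r" "r < (1 + sqrt 5) / 2"
  obtains c where "c > 0" "\<bar>1 - r\<bar> * c < 1" "\<bar>1 - r\<bar> / c < 2 - r"
proof (cases "r \<le> 1")
  case True
  with assms show thesis by (intro that[of 1]) auto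
next
  case False
  have "(2 * r - 1)\<^sup>2 < (sqrt 5)\<^sup>2" using assms False by (intro power_strict_mono) auto
  then have r: "r\<^sup>2 < r + 1" by (simp add: power2_eq_square algebra_simps)
  show thesis
  proof (rule that[of r])
    show "\<bar>1 - r\<bar> * r < 1" "\<bar>1 - r\<bar> / r < 2 - r"
      using r False by (simp_all add: field_simps power2_eq_square)
  qed (use assms in simp)
qed

lemma weighted_young:
  fixes a b c :: real
  assumes "c > 0"
  shows "2 * (a * b) \<le> c * a\<^sup>2 + b\<^sup>2 / c"
proof -
  have "0 \<le> (c * a - b)\<^sup>2 / c" using assms by simp
  also have "\<dots> = c * a\<^sup>2 + b\<^sup>2 / c - 2 * (a * b)"
    using assms by (simp add: power2_eq_square field_simps)
  finally show ?thesis by simp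
qed

text \<open>All variables are errors relative to a saddle point, with \<open>y\<close> standing for
  the image of the error \<open>x\<close> under the constraint matrix. Twice \<open>mono\<close> is
  expanded by the identity \<open>cosine\<close>, which turns each product of an increment with a
  new error into a difference of squares plus a squared increment.\<close>

lemma prox_admm_energy_step:
  fixes x1 x2 :: "'a::real_inner" and y1 y2 u1 u2 z1 z2 R :: "'b::real_inner"
  assumes pos: "\<beta> > 0" "r > 0"
    and R: "R = y2 - u2" and z2: "z2 = z1 - (r * \<beta>) *\<^sub>R R"
    and mono: "0 \<le> (z1 - \<beta> *\<^sub>R R) \<bullet> R - \<beta> * ((u2 - u1) \<bullet> y2)
                 - (\<rho> * ((x2 - x1) \<bullet> x2) - \<beta> * ((y2 - y1) \<bullet> y2))"
  defines "\<Theta> \<equiv> \<lambda>x y u z. (norm z)\<^sup>2 / (r * \<beta>) + \<beta> * (norm u)\<^sup>2 + (\<rho> * (norm x)\<^sup>2 - \<beta> * (norm y)\<^sup>2)"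
  shows "\<Theta> x2 y2 u2 z2 + (2 - r) * \<beta> * (norm R)\<^sup>2 + \<beta> * (norm (u2 - u1))\<^sup>2
      + (\<rho> * (norm (x2 - x1))\<^sup>2 - \<beta> * (norm (y2 - y1))\<^sup>2) + 2 * \<beta> * ((u2 - u1) \<bullet> R)
    \<le> \<Theta> x1 y1 u1 z1"
proof -
  have "(norm z2)\<^sup>2 = (norm z1)\<^sup>2 - 2 * (r * \<beta>) * (z1 \<bullet> R) + (r * \<beta>)\<^sup>2 * (norm R)\<^sup>2"
    unfolding z2 power2_norm_eq_inner
    by (simp add: inner_diff inner_commute[of R z1] power2_eq_square algebra_simps)
  then have z: "(norm z2)\<^sup>2 / (r * \<beta>) = (norm z1)\<^sup>2 / (r * \<beta>) - 2 * (z1 \<bullet> R) + r * \<beta> * (norm R)\<^sup>2"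
    using pos by (simp add: field_simps power2_eq_square)
  have cosine: "2 * ((p - q) \<bullet> p) = (norm p)\<^sup>2 - (norm q)\<^sup>2 + (norm (p - q))\<^sup>2" for p q :: "'c::real_inner"
    by (simp add: power2_norm_eq_inner inner_diff inner_commute algebra_simps)
  have xx: "2 * (\<rho> * ((x2 - x1) \<bullet> x2)) = \<rho> * (norm x2)\<^sup>2 - \<rho> * (norm x1)\<^sup>2 + \<rho> * (norm (x2 - x1))\<^sup>2"
    using arg_cong[OF cosine[of x2 x1], of "\<lambda>t. \<rho> * t"] by (simp add: algebra_simps)
  have yy: "2 * (\<beta> * ((y2 - y1) \<bullet> y2)) = \<beta> * (norm y2)\<^sup>2 - \<beta> * (norm y1)\<^sup>2 + \<beta> * (norm (y2 - y1))\<^sup>2"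
    using arg_cong[OF cosine[of y2 y1], of "\<lambda>t. \<beta> * t"] by (simp add: algebra_simps)
  have uu: "2 * (\<beta> * ((u2 - u1) \<bullet> u2)) = \<beta> * (norm u2)\<^sup>2 - \<beta> * (norm u1)\<^sup>2 + \<beta> * (norm (u2 - u1))\<^sup>2"
    using arg_cong[OF cosine[of u2 u1], of "\<lambda>t. \<beta> * t"] by (simp add: algebra_simps)
  \<comment> \<open>Splitting \<open>y2\<close> into \<open>R + u2\<close> leaves the cross term
    \<open>(u2 - u1) \<bullet> R\<close>, the only contribution of unknown sign.\<close>
  have y2: "\<beta> * ((u2 - u1) \<bullet> y2) = \<beta> * ((u2 - u1) \<bullet> R) + \<beta> * ((u2 - u1) \<bullet> u2)"
    by (simp add: R inner_diff algebra_simps)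
  have zR: "(z1 - \<beta> *\<^sub>R R) \<bullet> R = z1 \<bullet> R - \<beta> * (norm R)\<^sup>2"
    by (simp add: inner_diff power2_norm_eq_inner)
  show ?thesis
    using mono unfolding \<Theta>_def z zR y2 using xx yy uu by (simp add: algebra_simps)
qed

lemma decreasing_merit_tendsto_0:
  fixes W D :: "nat \<Rightarrow> real"
  assumes "\<And>l. 0 \<le> W l" "\<And>l. 0 \<le> D l" "\<And>l. W (Suc l) + D l \<le> W l"
  shows "D \<longlonglongrightarrow> 0" "W l \<le> W 0"
proof -
  have "decseq W" using assms(2,3) by (intro decseq_SucI) (smt (verit))
  then show "W l \<le> W 0" by (simp add: decseqD)
  obtain w where w: "W \<longlonglongrightarrow> w"
    using decseq_convergent[OF \<open>decseq W\<close>, of 0] assms(1) by blast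
  have "(\<lambda>l. W l - W (Suc l)) \<longlonglongrightarrow> w - w" using w by (intro tendsto_diff LIMSEQ_Suc)
  then show "D \<longlonglongrightarrow> 0"
    by (intro tendsto_sandwich[of "\<lambda>_. 0" D _ "\<lambda>l. W l - W (Suc l)"])
      (use assms(2,3) in \<open>auto intro!: always_eventually simp: algebra_simps\<close>)
qed

lemma tendsto_0_if_scaled_power2_norm:
  fixes F :: "nat \<Rightarrow> 'c::real_normed_vector"
  assumes "a > 0" "(\<lambda>l. a * (norm (F l))\<^sup>2) \<longlonglongrightarrow> 0"
  shows "F \<longlonglongrightarrow> 0"
proof -
  have "(\<lambda>l. a * (norm (F l))\<^sup>2 / a) \<longlonglongrightarrow> 0 / a"
    using assms by (intro tendsto_intros) auto
  then have "(\<lambda>l. (norm (F l))\<^sup>2) \<longlonglongrightarrow> 0" using assms(1) by simp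
  from tendsto_real_sqrt[OF this] show ?thesis by (simp add: tendsto_norm_zero_iff)
qed

text \<open>The merit function of Fazel, Pong, Sun and Tseng. The condition on \<open>v0\<close> says that \<open>U 0\<close> already
  comes from a \<open>u\<close>-step: an arbitrary starting point need not lie in \<open>S\<close>, so in the application
  the sequences start one step into the iteration.\<close>

lemma prox_admm_asymptotics:
  fixes B :: "real^'n^'m" and X :: "nat \<Rightarrow> real^'n" and U Z :: "nat \<Rightarrow> real^'m"
  assumes pos: "\<beta> > 0" "\<rho> > 0" "0 < r" "r < (1 + sqrt 5) / 2"
    and psd: "\<And>v. \<beta> * (norm (B *v v))\<^sup>2 \<le> \<rho> * (norm v)\<^sup>2"
    and saddle: "transpose B *v zs \<in> subdifferential h xs" "- zs \<in> normal_cone S us" "B *v xs - us = d"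
  defines "R \<equiv> \<lambda>l. B *v X l - d - U l"
  assumes z_step: "\<And>l. Z (Suc l) = Z l - (r * \<beta>) *\<^sub>R R (Suc l)"
    and x_opt: "\<And>l. transpose B *v (Z l - \<beta> *\<^sub>R (R (Suc l) + (U (Suc l) - U l)))
        - (\<rho> *\<^sub>R (X (Suc l) - X l) - \<beta> *\<^sub>R (transpose B *v (B *v (X (Suc l) - X l))))
        \<in> subdifferential h (X (Suc l))"
    and u_opt0: "v0 \<in> normal_cone S (U 0)" "v0 = - Z 0 + ((1 - r) * \<beta>) *\<^sub>R R 0"
    and u_opt: "\<And>l. - Z l + \<beta> *\<^sub>R R (Suc l) \<in> normal_cone S (U (Suc l))"
  shows "R \<longlonglongrightarrow> 0" "(\<lambda>l. U (Suc l) - U l) \<longlonglongrightarrow> 0" "(\<lambda>l. X (Suc l) - X l) \<longlonglongrightarrow> 0"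
    and "bounded (range X)" "bounded (range Z)"
proof -
  obtain c where c: "c > 0" "\<bar>1 - r\<bar> * c < 1" "\<bar>1 - r\<bar> / c < 2 - r"
    using golden_ratio_weight pos(3,4) by blast
  define dU where "dU l = U (Suc l) - U l" for l
  define dX where "dX l = X (Suc l) - X l" for l
  define T where "T v = \<rho> * (norm v)\<^sup>2 - \<beta> * (norm (B *v v))\<^sup>2" for v
  have T_nonneg: "0 \<le> T v" for v using psd[of v] by (simp add: T_def)
  define \<Theta> where "\<Theta> l = (norm (Z l - zs))\<^sup>2 / (r * \<beta>) + \<beta> * (norm (U l - us))\<^sup>2 + T (X l - xs)" for l
  have R_err: "R l = B *v (X l - xs) - (U l - us)" for l
    using saddle(3) by (simp add: R_def matrix_vector_mult_diff_distrib algebra_simps)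
  have step: "\<Theta> (Suc l) + (2 - r) * \<beta> * (norm (R (Suc l)))\<^sup>2 + \<beta> * (norm (dU l))\<^sup>2
      + T (dX l) + 2 * \<beta> * (dU l \<bullet> R (Suc l)) \<le> \<Theta> l" for l
  proof -
    let ?x = "X (Suc l) - xs" and ?u = "U (Suc l) - us" and ?z = "Z l - zs"
    \<comment> \<open>Both optimality conditions are compared with their saddle point counterparts.
      On adding \<open>m1\<close> and \<open>m2\<close>, the products with \<open>?u\<close> cancel,
      which leaves the hypothesis of the energy estimate.\<close>
    have m1: "0 \<le> (transpose B *v (Z l - \<beta> *\<^sub>R (R (Suc l) + dU l))
        - (\<rho> *\<^sub>R dX l - \<beta> *\<^sub>R (transpose B *v (B *v dX l))) - transpose B *v zs) \<bullet> ?x"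
      using subdifferential_monotone[OF x_opt saddle(1)] by (simp add: dU_def dX_def)
    have m2: "0 \<le> (- Z l + \<beta> *\<^sub>R R (Suc l) - - zs) \<bullet> ?u"
      using normal_cone_monotone[OF u_opt saddle(2)] .
    have BR: "B *v ?x = R (Suc l) + ?u" by (simp add: R_err)
    have m1': "0 \<le> (Z l - \<beta> *\<^sub>R (R (Suc l) + dU l)) \<bullet> (B *v ?x)
        - (\<rho> * (dX l \<bullet> ?x) - \<beta> * ((B *v dX l) \<bullet> (B *v ?x))) - zs \<bullet> (B *v ?x)"
      using m1 by (simp only: inner_diff_left inner_scaleR_left inner_transpose_mult)
    have "0 \<le> (?z - \<beta> *\<^sub>R R (Suc l)) \<bullet> R (Suc l) - \<beta> * (dU l \<bullet> (B *v ?x))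
        - (\<rho> * (dX l \<bullet> ?x) - \<beta> * ((B *v dX l) \<bullet> (B *v ?x)))"
    proof -
      have "(Z l - \<beta> *\<^sub>R (R (Suc l) + dU l)) \<bullet> (B *v ?x) - zs \<bullet> (B *v ?x)
          = (?z - \<beta> *\<^sub>R R (Suc l)) \<bullet> (R (Suc l) + ?u) - \<beta> * (dU l \<bullet> (B *v ?x))"
        unfolding BR[symmetric] by (simp add: inner_diff_left inner_add_left algebra_simps)
      moreover have "(- Z l + \<beta> *\<^sub>R R (Suc l) - - zs) \<bullet> ?u = - ((?z - \<beta> *\<^sub>R R (Suc l)) \<bullet> ?u)"
        by (simp add: inner_diff_left inner_add_left algebra_simps)
      ultimately show ?thesis using m1' m2 by (simp add: inner_add_right)
    qed
    moreover have "dX l = ?x - (X l - xs)" "dU l = ?u - (U l - us)"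
      "B *v dX l = B *v ?x - B *v (X l - xs)"
      by (simp_all add: dX_def dU_def matrix_vector_mult_diff_distrib)
    moreover have "Z (Suc l) - zs = ?z - (r * \<beta>) *\<^sub>R R (Suc l)" by (simp add: z_step)
    ultimately show ?thesis
      using prox_admm_energy_step[OF pos(1,3) R_err[of "Suc l"], of "Z (Suc l) - zs" ?z "U l - us"
          \<rho> ?x "X l - xs" "B *v (X l - xs)"]
      unfolding \<Theta>_def T_def by simp
  qed
  \<comment> \<open>Monotonicity of the normal cone between two consecutive \<open>u\<close>-steps.
    The multiplier update rewrites the older normal vector in terms of \<open>Z l\<close>, which
    produces the factor \<open>1 - r\<close>; for \<open>l = 0\<close> this vector is supplied by
    \<open>v0\<close>.\<close>
  have cross: "(1 - r) * (dU l \<bullet> R l) \<le> dU l \<bullet> R (Suc l)" for l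
  proof -
    have prev: "- Z l + ((1 - r) * \<beta>) *\<^sub>R R l \<in> normal_cone S (U l)"
    proof (cases l)
      case 0
      then show ?thesis using u_opt0 by simp
    next
      case (Suc j)
      then show ?thesis using u_opt[of j] by (simp add: z_step algebra_simps)
    qed
    have "0 \<le> (- Z l + \<beta> *\<^sub>R R (Suc l) - (- Z l + ((1 - r) * \<beta>) *\<^sub>R R l)) \<bullet> (U (Suc l) - U l)"
      using normal_cone_monotone[OF u_opt prev] .
    also have "\<dots> = \<beta> * (dU l \<bullet> R (Suc l) - (1 - r) * (dU l \<bullet> R l))"
      by (simp add: dU_def inner_diff_left inner_add_left inner_commute[of "R _"] algebra_simps)
    finally show ?thesis using pos(1) by (simp add: zero_le_mult_iff)
  qed
  define \<gamma> where "\<gamma> = \<bar>1 - r\<bar>"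
  have young: "- (\<gamma> * c * (norm (dU l))\<^sup>2 + \<gamma> / c * (norm (R l))\<^sup>2) \<le> 2 * (dU l \<bullet> R (Suc l))" for l
  proof -
    have "2 * \<bar>dU l \<bullet> R l\<bar> \<le> 2 * (norm (dU l) * norm (R l))"
      using Cauchy_Schwarz_ineq2[of "dU l" "R l"] by simp
    also have "\<dots> \<le> c * (norm (dU l))\<^sup>2 + (norm (R l))\<^sup>2 / c"
      using c(1) by (rule weighted_young)
    finally have "\<gamma> * (2 * \<bar>dU l \<bullet> R l\<bar>) \<le> \<gamma> * (c * (norm (dU l))\<^sup>2 + (norm (R l))\<^sup>2 / c)"
      by (intro mult_left_mono) (simp_all add: \<gamma>_def)
    moreover have "- (\<gamma> * (2 * \<bar>dU l \<bullet> R l\<bar>)) \<le> 2 * ((1 - r) * (dU l \<bullet> R l))"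
    proof -
      have "\<gamma> * \<bar>dU l \<bullet> R l\<bar> = \<bar>(1 - r) * (dU l \<bullet> R l)\<bar>" by (simp add: \<gamma>_def abs_mult)
      then show ?thesis by linarith
    qed
    moreover have "\<gamma> * (c * (norm (dU l))\<^sup>2 + (norm (R l))\<^sup>2 / c)
        = \<gamma> * c * (norm (dU l))\<^sup>2 + \<gamma> / c * (norm (R l))\<^sup>2"
      by (simp add: distrib_left)
    ultimately show ?thesis using cross[of l] by linarith
  qed
  \<comment> \<open>The term added to \<open>\<Theta>\<close> absorbs the previous residual that
    Young's inequality leaves behind; \<open>D\<close> is the decrease that remains, with
    coefficients positive by the choice of \<open>c\<close>.\<close>
  define W where "W l = \<Theta> l + \<beta> * (\<gamma> / c) * (norm (R l))\<^sup>2" for l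
  define D where "D l = \<beta> * (2 - r - \<gamma> / c) * (norm (R (Suc l)))\<^sup>2
      + \<beta> * (1 - \<gamma> * c) * (norm (dU l))\<^sup>2 + T (dX l)" for l
  have coef: "0 < \<beta> * (2 - r - \<gamma> / c)" "0 < \<beta> * (1 - \<gamma> * c)"
    using pos c by (simp_all add: \<gamma>_def)
  have \<Theta>_nonneg: "0 \<le> \<Theta> l" for l
    using pos T_nonneg by (simp add: \<Theta>_def)
  have \<Theta>_W: "\<Theta> l \<le> W l" for l
    using pos c by (simp add: W_def \<gamma>_def)
  have D_parts: "0 \<le> \<beta> * (2 - r - \<gamma> / c) * (norm (R (Suc l)))\<^sup>2"
    "0 \<le> \<beta> * (1 - \<gamma> * c) * (norm (dU l))\<^sup>2" for l
    using coef by (simp_all add: less_imp_le)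
  have W_nonneg: "0 \<le> W l" for l using \<Theta>_nonneg \<Theta>_W by (rule order_trans)
  have D_nonneg: "0 \<le> D l" for l using D_parts T_nonneg[of "dX l"] unfolding D_def by (intro add_nonneg_nonneg)
  have W_step: "W (Suc l) + D l \<le> W l" for l
    using step[of l] mult_left_mono[OF young[of l], of \<beta>] pos(1) by (simp add: W_def D_def algebra_simps)
  have D0: "D \<longlonglongrightarrow> 0" and W_le: "W l \<le> W 0" for l
    using decreasing_merit_tendsto_0[of W D, OF W_nonneg D_nonneg W_step] by blast+
  have part: "E \<longlonglongrightarrow> 0" if "\<And>l. 0 \<le> E l" "\<And>l. E l \<le> D l" for E
    using tendsto_sandwich[of "\<lambda>_. 0" E sequentially D 0] D0 that by auto
  have "(\<lambda>l. R (Suc l)) \<longlonglongrightarrow> 0"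
    using D_parts T_nonneg by (intro tendsto_0_if_scaled_power2_norm[OF coef(1) part]) (simp_all add: D_def)
  then show R0: "R \<longlonglongrightarrow> 0" by (rule LIMSEQ_imp_Suc)
  have dU0: "dU \<longlonglongrightarrow> 0"
    using D_parts T_nonneg by (intro tendsto_0_if_scaled_power2_norm[OF coef(2) part]) (simp_all add: D_def)
  then show "(\<lambda>l. U (Suc l) - U l) \<longlonglongrightarrow> 0" by (simp add: dU_def[abs_def])
  have T0: "(\<lambda>l. T (dX l)) \<longlonglongrightarrow> 0"
    using D_parts T_nonneg by (intro part) (simp_all add: D_def)
  \<comment> \<open>The seminorm \<open>T\<close> controls only a difference of squares. The missing
    part \<open>B *v dX l\<close> is recovered from the change of the residual and of
    \<open>U\<close>, after which \<open>\<rho> > 0\<close> gives control of \<open>dX\<close>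
    itself.\<close>
  have "(\<lambda>l. R (Suc l) - R l + dU l) \<longlonglongrightarrow> 0 - 0 + 0"
    by (intro tendsto_intros dU0 R0 LIMSEQ_Suc[OF R0])
  moreover have "R (Suc l) - R l + dU l = B *v dX l" for l
    by (simp add: R_def dU_def dX_def matrix_vector_mult_diff_distrib)
  ultimately have "(\<lambda>l. B *v dX l) \<longlonglongrightarrow> 0" by simp
  then have "(\<lambda>l. T (dX l) + \<beta> * (norm (B *v dX l))\<^sup>2) \<longlonglongrightarrow> 0 + \<beta> * (norm (0::real^'m))\<^sup>2"
    using T0 by (intro tendsto_intros)
  then have "(\<lambda>l. \<rho> * (norm (dX l))\<^sup>2) \<longlonglongrightarrow> 0" by (simp add: T_def)
  then have "dX \<longlonglongrightarrow> 0" by (rule tendsto_0_if_scaled_power2_norm[OF pos(2)])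
  then show "(\<lambda>l. X (Suc l) - X l) \<longlonglongrightarrow> 0" by (simp add: dX_def[abs_def])
  have \<Theta>_le: "\<Theta> l \<le> W 0" for l using \<Theta>_W[of l] W_le[of l] by linarith
  have z_bd: "(norm (Z l - zs))\<^sup>2 \<le> W 0 * (r * \<beta>)" for l
  proof -
    have "(norm (Z l - zs))\<^sup>2 / (r * \<beta>) \<le> W 0"
      using \<Theta>_le[of l] pos T_nonneg[of "X l - xs"] unfolding \<Theta>_def
      by (smt (verit) mult_nonneg_nonneg zero_le_power2)
    then show ?thesis using pos by (simp add: pos_divide_le_eq)
  qed
  have "norm (Z l) \<le> norm zs + sqrt (W 0 * (r * \<beta>))" for l
  proof -
    have "norm (Z l - zs) \<le> sqrt (W 0 * (r * \<beta>))" using z_bd by (rule real_le_rsqrt)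
    then show ?thesis using norm_triangle_sub[of "Z l" zs] by linarith
  qed
  then show "bounded (range Z)" by (auto simp: bounded_iff)
  \<comment> \<open>The same completion for boundedness: \<open>B *v (X l - xs)\<close> is bounded
    through the residual and the error of \<open>U\<close>, and together with \<open>T\<close> this
    bounds \<open>X l - xs\<close>.\<close>
  obtain K where K: "\<And>l. norm (R l) \<le> K"
    using convergent_imp_bounded[OF R0] by (auto simp: bounded_iff)
  define K1 where "K1 = K + sqrt (W 0 / \<beta>)"
  have "norm (X l) \<le> norm xs + sqrt ((W 0 + \<beta> * K1\<^sup>2) / \<rho>)" for l
  proof -
    have "\<beta> * (norm (U l - us))\<^sup>2 \<le> W 0" and T_le: "T (X l - xs) \<le> W 0"
      using \<Theta>_le[of l] pos T_nonneg[of "X l - xs"] unfolding \<Theta>_def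
      by (smt (verit) mult_nonneg_nonneg zero_le_power2 divide_nonneg_pos mult_pos_pos)+
    then have "(norm (U l - us))\<^sup>2 \<le> W 0 / \<beta>" using pos by (simp add: pos_le_divide_eq mult.commute)
    then have "norm (U l - us) \<le> sqrt (W 0 / \<beta>)" by (rule real_le_rsqrt)
    moreover have "B *v (X l - xs) = R l + (U l - us)" by (simp add: R_err)
    ultimately have "norm (B *v (X l - xs)) \<le> K1"
      using K[of l] norm_triangle_ineq[of "R l" "U l - us"] by (simp add: K1_def)
    then have "\<beta> * (norm (B *v (X l - xs)))\<^sup>2 \<le> \<beta> * K1\<^sup>2"
      using pos by (intro mult_left_mono power_mono) auto
    then have "\<rho> * (norm (X l - xs))\<^sup>2 \<le> W 0 + \<beta> * K1\<^sup>2" using T_le by (simp add: T_def)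
    then have "(norm (X l - xs))\<^sup>2 \<le> (W 0 + \<beta> * K1\<^sup>2) / \<rho>"
      using pos by (simp add: pos_le_divide_eq mult.commute)
    then have "norm (X l - xs) \<le> sqrt ((W 0 + \<beta> * K1\<^sup>2) / \<rho>)" by (rule real_le_rsqrt)
    then show ?thesis using norm_triangle_sub[of "X l" xs] by linarith
  qed
  then show "bounded (range X)" by (auto simp: bounded_iff)
qed

section \<open>Weighted group norms, and minimizers of a convex function plus a quadratic\<close>

lemma group_norms_triangle: "group_norms G (v + v') $ i \<le> group_norms G v $ i + group_norms G v' $ i"
  using L2_set_triangle_ineq[of "\<lambda>j. v $ j" "\<lambda>j. v' $ j" "G i"]
  by (simp add: group_norms_def flip: vector_add_component)

lemma group_norms_scaleR: "group_norms G (c *\<^sub>R v) $ i = \<bar>c\<bar> * group_norms G v $ i"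
proof -
  have "L2_set (\<lambda>j. (c *\<^sub>R v) $ j) (G i) = \<bar>c\<bar> * L2_set (\<lambda>j. v $ j) (G i)"
    by (simp only: L2_set_def vector_scaleR_component real_scaleR_def power_mult_distrib
        sum_distrib_left[symmetric] real_sqrt_mult real_sqrt_abs)
  then show ?thesis by (simp add: group_norms_def)
qed

lemma group_norms_nonneg: "0 \<le> group_norms G v $ i"
  by (simp add: group_norms_def)

context
  fixes w :: "real^'q" and G :: "'q::finite \<Rightarrow> 'n::finite set"
  assumes w: "\<And>i. w $ i > 0"
begin

lemma weighted_group_norm_nonneg: "0 \<le> weighted_group_norm w G v"
  unfolding weighted_group_norm_def
  by (intro sum_nonneg mult_nonneg_nonneg group_norms_nonneg) (simp add: w less_imp_le)

lemma weighted_group_norm_triangle: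
  "weighted_group_norm w G (v + v') \<le> weighted_group_norm w G v + weighted_group_norm w G v'"
  unfolding weighted_group_norm_def sum.distrib[symmetric] distrib_left[symmetric]
  by (intro sum_mono mult_left_mono group_norms_triangle) (simp add: w less_imp_le)

lemma weighted_group_norm_scaleR:
  "weighted_group_norm w G (c *\<^sub>R v) = \<bar>c\<bar> * weighted_group_norm w G v"
  unfolding weighted_group_norm_def
  by (simp add: group_norms_scaleR sum_distrib_left mult.left_commute)

lemma convex_on_weighted_group_norm: "convex_on UNIV (weighted_group_norm w G)"
proof (rule convex_onI)
  fix t :: real and x y :: "real^'n"
  assume "0 < t" "t < 1"
  then show "weighted_group_norm w G ((1 - t) *\<^sub>R x + t *\<^sub>R y)
      \<le> (1 - t) * weighted_group_norm w G x + t * weighted_group_norm w G y"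
    using weighted_group_norm_triangle[of "(1 - t) *\<^sub>R x" "t *\<^sub>R y"]
    by (simp add: weighted_group_norm_scaleR)
qed simp

lemma continuous_on_weighted_group_norm: "continuous_on S (weighted_group_norm w G)"
  unfolding weighted_group_norm_def group_norms_def L2_set_def
  by (simp, intro continuous_intros)

text \<open>Coercivity: every coordinate lies in some group, and the least weight \<open>a\<close>
  is positive. It makes sublevel sets bounded, so that the subproblem has a solution.\<close>

lemma norm_le_weighted_group_norm:
  assumes "(\<Union>i. G i) = UNIV"
  obtains K where "\<And>v. norm v \<le> K * weighted_group_norm w G v"
proof -
  define a where "a = Min (range (($) w))"
  have a: "a > 0" "\<And>i. a \<le> w $ i" using w by (auto simp: a_def)
  have "\<bar>v $ j\<bar> \<le> weighted_group_norm w G v / a" for v j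
  proof -
    obtain i where "j \<in> G i" using assms by blast
    have "a * \<bar>v $ j\<bar> \<le> w $ i * L2_set (\<lambda>j. v $ j) (G i)"
    proof (rule mult_mono)
      have "\<bar>v $ j\<bar> = L2_set (\<lambda>j. v $ j) {j}" by (simp add: L2_set_def)
      also have "\<dots> \<le> L2_set (\<lambda>j. v $ j) (G i)"
        unfolding L2_set_def using \<open>j \<in> G i\<close> by (intro real_sqrt_le_mono sum_mono2) auto
      finally show "\<bar>v $ j\<bar> \<le> L2_set (\<lambda>j. v $ j) (G i)" .
    qed (use a w[of i] in \<open>auto simp: less_imp_le\<close>)
    also have "\<dots> \<le> weighted_group_norm w G v"
      unfolding weighted_group_norm_def group_norms_def
      using member_le_sum[of i UNIV "\<lambda>i. w $ i * L2_set (\<lambda>j. v $ j) (G i)"] w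
      by (simp add: less_imp_le)
    finally show ?thesis using a by (simp add: pos_le_divide_eq mult.commute)
  qed
  then have "(\<Sum>j\<in>UNIV. \<bar>v $ j\<bar>) \<le> (\<Sum>j\<in>(UNIV::'n set). weighted_group_norm w G v / a)" for v
    by (intro sum_mono)
  then have "norm v \<le> (real CARD('n) / a) * weighted_group_norm w G v" for v
    using order_trans[OF norm_le_l1_cart[of v]] by fastforce
  then show thesis by (rule that)
qed

end

text \<open>The minimizer is compared with points of the segment towards \<open>y\<close>, along
  which \<open>-g\<close> acts as the gradient of \<open>q\<close>. The \<open>x\<close>-step uses
  it on the whole space, the \<open>u\<close>-step with \<open>h = 0\<close> on the constraint
  ball.\<close>

lemma convex_plus_quadratic_minimizer:
  fixes h q :: "'a::real_inner \<Rightarrow> real"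
  assumes h: "convex_on S h" and x0: "x0 \<in> S" and y: "y \<in> S"
    and min: "\<And>v. v \<in> S \<Longrightarrow> h x0 + q x0 \<le> h v + q v"
    and q: "\<And>t. q (x0 + t *\<^sub>R (y - x0)) = q x0 - t * (g \<bullet> (y - x0)) + t\<^sup>2 * c"
  shows "h x0 + g \<bullet> (y - x0) \<le> h y"
proof -
  have "0 \<le> t * (h y - h x0 - g \<bullet> (y - x0)) + t\<^sup>2 * c" if t: "0 < t" "t \<le> 1" for t
  proof -
    have eq: "x0 + t *\<^sub>R (y - x0) = (1 - t) *\<^sub>R x0 + t *\<^sub>R y" by (simp add: algebra_simps)
    have "x0 + t *\<^sub>R (y - x0) \<in> S"
      unfolding eq using convexD[OF convex_on_imp_convex[OF h] x0 y, of "1 - t" t] t by simp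
    then have "h x0 + q x0 \<le> h (x0 + t *\<^sub>R (y - x0)) + q (x0 + t *\<^sub>R (y - x0))" by (rule min)
    moreover have "h (x0 + t *\<^sub>R (y - x0)) \<le> (1 - t) * h x0 + t * h y"
      unfolding eq using convex_onD[OF h, of t x0 y] t x0 y by simp
    ultimately show ?thesis unfolding q by (simp add: algebra_simps)
  qed
  then have "0 \<le> h y - h x0 - g \<bullet> (y - x0)" by (rule nonneg_if_quadratic_nonneg)
  then show ?thesis by simp
qed

section \<open>Optimality conditions of the two ADMM steps\<close>

lemma dot_add_scaleR_self:
  fixes p e :: "'a::real_inner"
  shows "(p + t *\<^sub>R e) \<bullet> (p + t *\<^sub>R e) = p \<bullet> p + 2 * t * (p \<bullet> e) + t\<^sup>2 * (e \<bullet> e)"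
  by (simp add: inner_add inner_commute[of e p] power2_eq_square algebra_simps)

lemma prox_matrix_mult:
  "prox_matrix \<phi> A b x \<beta> *v v = prox_rho \<phi> A b x \<beta> *\<^sub>R v
     - \<beta> *\<^sub>R (transpose (lin_A \<phi> A b x) *v (lin_A \<phi> A b x *v v))"
  unfolding prox_matrix_def
  by (simp add: matrix_vector_mult_diff_rdistrib scaleR_matrix_vector_assoc[symmetric]
      matrix_vector_mul_assoc)

lemma aug_lagrangian_eq:
  "aug_lagrangian \<psi> G \<phi> A b \<sigma> x \<beta> v u z =
    (if u \<in> lin_U \<phi> A b \<sigma> x
     then ereal (weighted_group_norm (weights \<psi> G x) G v
        - z \<bullet> (lin_A \<phi> A b x *v v - u - lin_b \<phi> A b x)
        + \<beta> / 2 * (norm (lin_A \<phi> A b x *v v - u - lin_b \<phi> A b x))\<^sup>2)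
     else \<infinity>)"
  by (simp add: aug_lagrangian_def indicator_fun_def Let_def)

text \<open>Membership of \<open>u\<close> in the constraint ball makes the extended-real objective
  finite, so minimality passes to the reals. The objective is then the group norm plus a quadratic
  \<open>q\<close> whose gradient at \<open>x1\<close> is the negative of the stated vector.\<close>

lemma prox_x_step_subgradient:
  fixes A :: "real^'n^'m" and b :: "real^'m" and \<phi> :: "real \<Rightarrow> real" and x :: "real^'n" and \<beta> :: real
  defines "B \<equiv> lin_A \<phi> A b x" and "d \<equiv> lin_b \<phi> A b x" and "\<rho> \<equiv> prox_rho \<phi> A b x \<beta>"
  assumes h: "convex_on UNIV (weighted_group_norm (weights \<psi> G x) G)" (is "convex_on _ ?h")
    and u: "u \<in> lin_U \<phi> A b \<sigma> x"
    and min: "is_arg_min (\<lambda>v. aug_lagrangian \<psi> G \<phi> A b \<sigma> x \<beta> v u z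
               + ereal (1/2 * ((v - x0) \<bullet> (prox_matrix \<phi> A b x \<beta> *v (v - x0))))) (\<lambda>_. True) x1"
  shows "transpose B *v (z - \<beta> *\<^sub>R (B *v x1 - u - d))
      - (\<rho> *\<^sub>R (x1 - x0) - \<beta> *\<^sub>R (transpose B *v (B *v (x1 - x0)))) \<in> subdifferential ?h x1"
    (is "?g \<in> _")
proof -
  define q where "q v = - (z \<bullet> (B *v v - u - d)) + \<beta> / 2 * (norm (B *v v - u - d))\<^sup>2
      + (\<rho> * ((v - x0) \<bullet> (v - x0)) - \<beta> * ((B *v (v - x0)) \<bullet> (B *v (v - x0)))) / 2" for v
  have le: "?h x1 + q x1 \<le> ?h v + q v" for v
  proof -
    have form: "e \<bullet> (prox_matrix \<phi> A b x \<beta> *v e) = \<rho> * (e \<bullet> e) - \<beta> * ((B *v e) \<bullet> (B *v e))" for e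
      unfolding prox_matrix_mult B_def \<rho>_def inner_diff_right inner_scaleR_right
      by (simp only: inner_commute[of e "transpose _ *v _"] inner_transpose_mult)
    show ?thesis
      using min[unfolded is_arg_min_def, THEN conjunct2] u
      unfolding aug_lagrangian_eq form B_def[symmetric] d_def[symmetric] q_def
      by (auto simp: not_less dest!: spec[of _ v])
  qed
  have "?h x1 + ?g \<bullet> (y - x1) \<le> ?h y" for y
  proof (rule convex_plus_quadratic_minimizer[OF h, of x1 y q])
    fix t :: real
    define e where "e = y - x1"
    define r0 where "r0 = B *v x1 - u - d"
    define a where "a = x1 - x0"
    have r: "B *v (x1 + t *\<^sub>R e) - u - d = r0 + t *\<^sub>R (B *v e)"
      by (simp add: r0_def matrix_vector_right_distrib matrix_vector_mult_scaleR)
    have a: "x1 + t *\<^sub>R e - x0 = a + t *\<^sub>R e" by (simp add: a_def)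
    have Ba: "B *v (a + t *\<^sub>R e) = B *v a + t *\<^sub>R (B *v e)"
      by (simp add: matrix_vector_right_distrib matrix_vector_mult_scaleR)
    have g: "(transpose B *v (z - \<beta> *\<^sub>R r0) - (\<rho> *\<^sub>R a - \<beta> *\<^sub>R (transpose B *v (B *v a)))) \<bullet> e
        = z \<bullet> (B *v e) - \<beta> * (r0 \<bullet> (B *v e)) - \<rho> * (a \<bullet> e) + \<beta> * ((B *v a) \<bullet> (B *v e))"
      by (simp only: inner_diff_left inner_scaleR_left inner_transpose_mult)
    show "q (x1 + t *\<^sub>R (y - x1)) = q x1 - t * (?g \<bullet> (y - x1))
        + t\<^sup>2 * (\<beta> / 2 * ((B *v e) \<bullet> (B *v e)) + (\<rho> * (e \<bullet> e) - \<beta> * ((B *v e) \<bullet> (B *v e))) / 2)"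
      unfolding q_def e_def[symmetric] r a Ba unfolding r0_def[symmetric] a_def[symmetric] g
        power2_norm_eq_inner dot_add_scaleR_self unfolding inner_add_right inner_scaleR_right
      by (simp add: add_divide_distrib diff_divide_distrib algebra_simps)
  qed (use le in auto)
  then show ?thesis by (simp add: subdifferential_def)
qed

text \<open>As \<open>S\<close> is nonempty, a minimizer cannot have value infinity and so lies in
  \<open>S\<close>, whatever \<open>v\<close> and \<open>z\<close> are. What remains is a quadratic
  minimized over a convex set.\<close>

lemma prox_u_step_normal:
  fixes A :: "real^'n^'m" and b :: "real^'m" and \<phi> :: "real \<Rightarrow> real" and x :: "real^'n" and \<sigma> :: real
  defines "B \<equiv> lin_A \<phi> A b x" and "d \<equiv> lin_b \<phi> A b x" and "S \<equiv> lin_U \<phi> A b \<sigma> x"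
  assumes S: "convex S" "S \<noteq> {}"
    and min: "is_arg_min (\<lambda>u. aug_lagrangian \<psi> G \<phi> A b \<sigma> x \<beta> v u z) (\<lambda>_. True) u1"
  shows "- z + \<beta> *\<^sub>R (B *v v - d - u1) \<in> normal_cone S u1" (is "?g \<in> _")
proof -
  define q where "q u = - (z \<bullet> (B *v v - u - d)) + \<beta> / 2 * (norm (B *v v - u - d))\<^sup>2" for u
  let ?L = "\<lambda>u. aug_lagrangian \<psi> G \<phi> A b \<sigma> x \<beta> v u z"
  have L: "?L u = (if u \<in> S then ereal (weighted_group_norm (weights \<psi> G x) G v + q u) else \<infinity>)" for u
    by (simp add: aug_lagrangian_eq q_def B_def d_def S_def)
  have le: "?L u1 \<le> ?L u" for u
    using min by (auto simp: is_arg_min_def not_less)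
  have u1: "u1 \<in> S"
  proof (rule ccontr)
    assume "u1 \<notin> S"
    moreover obtain u where "u \<in> S" using S(2) by blast
    ultimately show False using le[of u] by (simp add: L)
  qed
  have min_q: "0 + q u1 \<le> 0 + q u" if "u \<in> S" for u
    using le[of u] u1 that by (simp add: L)
  have "?g \<bullet> (u - u1) \<le> 0" if u: "u \<in> S" for u
  proof -
    have "0 + ?g \<bullet> (u - u1) \<le> 0"
    proof (rule convex_plus_quadratic_minimizer[of S "\<lambda>_. 0" u1 u q, OF _ u1 u min_q])
      show "convex_on S (\<lambda>_. 0)" using S(1) by (simp add: convex_on_def)
      fix t :: real
      define e where "e = u - u1"
      define r0 where "r0 = B *v v - u1 - d"
      have r: "B *v v - (u1 + t *\<^sub>R e) - d = r0 + (- t) *\<^sub>R e" "B *v v - d - u1 = r0"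
        by (simp_all add: r0_def)
      show "q (u1 + t *\<^sub>R (u - u1)) = q u1 - t * (?g \<bullet> (u - u1)) + t\<^sup>2 * (\<beta> / 2 * (e \<bullet> e))"
        unfolding q_def e_def[symmetric] r r0_def[symmetric] power2_norm_eq_inner dot_add_scaleR_self
        unfolding inner_add_left inner_add_right inner_scaleR_left inner_scaleR_right
        by (simp add: algebra_simps)
    qed
    then show ?thesis by simp
  qed
  then show ?thesis using u1 by (simp add: normal_cone_def)
qed

section \<open>The linearized residual and the map \<open>lin_P\<close>\<close>

lemma diag_mult_vec: "diag u *v y = u * y"
  by (simp add: vec_eq_iff diag_def matrix_vector_mult_def if_distrib[of "\<lambda>c. c * _"] cong: if_cong)

lemma power2_norm_mult_vec: "(norm (u * y :: real^'m))\<^sup>2 = (\<Sum>i\<in>UNIV. (u $ i)\<^sup>2 * (y $ i)\<^sup>2)"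
  unfolding power2_norm_eq_inner inner_vec_def by (simp add: power2_eq_square mult_ac)

lemma lin_residual: "lin_A \<phi> A b x *v v - lin_b \<phi> A b x = upsilon \<phi> A b x * resid A b v"
  by (simp add: lin_A_def lin_b_def resid_def matrix_vector_mul_assoc[symmetric] diag_mult_vec
      right_diff_distrib)

text \<open>\<open>pinv A *v b\<close> has zero linearized residual, so moving towards it scales the
  residual of \<open>v\<close> by \<open>t\<close>; the factor places the result on the sphere of
  radius \<open>sqrt s\<close>.\<close>

lemma lin_P_feasible:
  assumes "rank A = CARD('m)" and "0 < lin_sigma \<phi> A (b::real^'m) \<sigma> x"
  shows "(norm (lin_A \<phi> A b x *v lin_P \<phi> A b \<sigma> x v - lin_b \<phi> A b x))\<^sup>2 \<le> lin_sigma \<phi> A b \<sigma> x"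
proof -
  define s where "s = lin_sigma \<phi> A b \<sigma> x"
  define n where "n = norm (lin_A \<phi> A b x *v v - lin_b \<phi> A b x)"
  have s: "s > 0" using assms(2) by (simp add: s_def)
  show ?thesis
  proof (cases "n\<^sup>2 \<le> s")
    case True
    then show ?thesis by (simp add: lin_P_def Let_def s_def n_def)
  next
    case False
    then have "n \<noteq> 0" using s by auto
    then have "n > 0" by (simp add: n_def)
    define t where "t = sqrt s / n"
    have "t \<ge> 0" using s \<open>n > 0\<close> by (simp add: t_def)
    have P: "lin_P \<phi> A b \<sigma> x v = (1 - t) *\<^sub>R (pinv A *v b) + t *\<^sub>R v"
      using False by (simp add: lin_P_def Let_def s_def n_def t_def)
    have "lin_A \<phi> A b x *v (pinv A *v b) - lin_b \<phi> A b x = 0"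
      unfolding lin_residual by (simp add: resid_def pinv_right_inverse[OF assms(1)])
    then have p: "lin_A \<phi> A b x *v (pinv A *v b) = lin_b \<phi> A b x" by simp
    have "lin_A \<phi> A b x *v lin_P \<phi> A b \<sigma> x v - lin_b \<phi> A b x
        = t *\<^sub>R (lin_A \<phi> A b x *v v - lin_b \<phi> A b x)"
      unfolding P matrix_vector_right_distrib matrix_vector_mult_scaleR p by (simp add: algebra_simps)
    then have "norm (lin_A \<phi> A b x *v lin_P \<phi> A b \<sigma> x v - lin_b \<phi> A b x) = t * n"
      using \<open>t \<ge> 0\<close> by (simp add: n_def)
    also have "\<dots> = sqrt s" using \<open>n > 0\<close> by (simp add: t_def)
    finally show ?thesis using s by (simp add: s_def)
  qed
qed

text \<open>If \<open>lin_P\<close> moves \<open>v\<close>, it gives \<open>pinv A *v b\<close> the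
  weight \<open>1 - t\<close>. Since \<open>norm u\<close> is at most \<open>sqrt s\<close>, this
  weight is bounded by the distance of the linearized residual from \<open>u\<close> divided by
  \<open>sqrt s\<close>; convexity does the rest.\<close>

lemma lin_P_weighted_group_norm_le:
  assumes w: "\<And>i. w $ i > 0" and s: "0 < lin_sigma \<phi> A b \<sigma> x" and u: "u \<in> lin_U \<phi> A b \<sigma> x"
  shows "weighted_group_norm w G (lin_P \<phi> A b \<sigma> x v) \<le> weighted_group_norm w G v
    + norm (lin_A \<phi> A b x *v v - lin_b \<phi> A b x - u) / sqrt (lin_sigma \<phi> A b \<sigma> x)
      * weighted_group_norm w G (pinv A *v b)"
proof -
  define s where "s = lin_sigma \<phi> A b \<sigma> x"
  define y where "y = lin_A \<phi> A b x *v v - lin_b \<phi> A b x"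
  let ?h = "weighted_group_norm w G"
  have h: "0 \<le> ?h v" for v using w by (rule weighted_group_norm_nonneg)
  have "s > 0" using s by (simp add: s_def)
  show ?thesis
  proof (cases "(norm y)\<^sup>2 \<le> s")
    case True
    then have "lin_P \<phi> A b \<sigma> x v = v" by (simp add: lin_P_def Let_def s_def y_def)
    then show ?thesis using h[of "pinv A *v b"] \<open>s > 0\<close> by (simp add: s_def)
  next
    case False
    then have gt: "sqrt s < norm y" by (simp add: real_less_lsqrt not_le)
    have "norm u \<le> sqrt s" using u by (auto simp: lin_U_def s_def intro: real_le_rsqrt)
    have pos: "0 < sqrt s" using \<open>s > 0\<close> by simp
    define t where "t = sqrt s / norm y"
    have "norm y > 0" using gt pos by linarith
    then have t: "0 \<le> t" "t \<le> 1" using gt pos by (simp_all add: t_def)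
    have "1 - t = (norm y - sqrt s) / norm y" using \<open>norm y > 0\<close> by (simp add: t_def diff_divide_distrib)
    also have "\<dots> \<le> norm (y - u) / norm y"
      using norm_triangle_sub[of y u] \<open>norm u \<le> sqrt s\<close> by (intro divide_right_mono) auto
    also have "\<dots> \<le> norm (y - u) / sqrt s"
      using gt pos by (intro divide_left_mono mult_pos_pos) auto
    finally have t': "1 - t \<le> norm (y - u) / sqrt s" .
    have "lin_P \<phi> A b \<sigma> x v = (1 - t) *\<^sub>R (pinv A *v b) + t *\<^sub>R v"
      using False by (simp add: lin_P_def Let_def s_def y_def t_def)
    then have "?h (lin_P \<phi> A b \<sigma> x v) \<le> (1 - t) * ?h (pinv A *v b) + t * ?h v"
      using convex_onD[OF convex_on_weighted_group_norm[OF w], of t "pinv A *v b" v] t by simp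
    also have "\<dots> \<le> norm (y - u) / sqrt s * ?h (pinv A *v b) + 1 * ?h v"
      using t t' h by (intro add_mono mult_right_mono)
    finally show ?thesis by (simp add: s_def y_def)
  qed
qed

section \<open>Consequences of the assumptions on \<open>\<psi>\<close> and
  \<open>\<phi>\<close>\<close>

lemma weights_pos:
  assumes "continuous_on {0..} \<psi>" "\<psi> 0 = 0" "\<forall>t>0. \<psi> differentiable (at t) \<and> deriv \<psi> t > 0"
    and "\<exists>L>0. (deriv \<psi> \<longlongrightarrow> L) (at_right 0)"
  shows "weights \<psi> G x $ i > 0"
proof -
  obtain L where L: "L > 0" "(deriv \<psi> \<longlongrightarrow> L) (at_right 0)" using assms(4) by blast
  show ?thesis
  proof (cases "group_norms G x $ i = 0")
    case True
    then show ?thesis using right_deriv_at_0(1)[OF assms(1,2) _ L(2)] assms(3) L(1)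
      by (simp add: weights_def)
  next
    case False
    then have "group_norms G x $ i > 0" using group_norms_nonneg[of G x i] by simp
    then show ?thesis using right_deriv_at_pos(1) assms(3) by (simp add: weights_def)
  qed
qed

context
  fixes \<phi> :: "real \<Rightarrow> real" and A :: "real^'n^'m" and b :: "real^'m" and \<sigma> :: real
  assumes cont: "continuous_on {0..} \<phi>" and conc: "concave_on {0..} \<phi>" and \<phi>0: "\<phi> 0 = 0"
    and diff: "\<forall>t>0. \<phi> differentiable (at t) \<and> deriv \<phi> t \<ge> 0"
    and lim: "\<exists>L>0. (deriv \<phi> \<longlongrightarrow> L) (at_right 0)"
    and rank: "rank A = CARD('m)"
begin

lemma loss_right_deriv_nonneg: "0 \<le> right_deriv \<phi> t" if "t \<ge> 0"
proof -
  obtain L where L: "L > 0" "(deriv \<phi> \<longlongrightarrow> L) (at_right 0)" using lim by blast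
  show ?thesis
  proof (cases "t = 0")
    case True
    then show ?thesis using right_deriv_at_0(1)[OF cont \<phi>0 _ L(2)] diff L(1) by simp
  next
    case False
    then have "t > 0" using that by simp
    then show ?thesis using right_deriv_at_pos(1) diff by simp
  qed
qed

lemma loss_tangent: "\<phi> s \<le> \<phi> t + right_deriv \<phi> t * (s - t)" if "0 \<le> s" "0 \<le> t"
proof -
  obtain L where L: "(deriv \<phi> \<longlongrightarrow> L) (at_right 0)" using lim by blast
  show ?thesis using diff by (intro concave_le_tangent[OF conc cont \<phi>0 _ L that]) blast
qed

lemma upsilon_sq: "(upsilon \<phi> A b x $ i)\<^sup>2 = right_deriv \<phi> ((resid A b x $ i)\<^sup>2)"
  using loss_right_deriv_nonneg[of "(resid A b x $ i)\<^sup>2"]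
  by (simp add: upsilon_def power2_eq_square[of "resid A b x $ i"])

lemma norm_lin_residual_sq:
  "(norm (lin_A \<phi> A b x *v v - lin_b \<phi> A b x))\<^sup>2
    = (\<Sum>i\<in>UNIV. right_deriv \<phi> ((resid A b x $ i)\<^sup>2) * (resid A b v $ i)\<^sup>2)"
  unfolding lin_residual power2_norm_mult_vec upsilon_sq ..

text \<open>Tangent bounds for the concave \<open>\<phi>\<close>, taken in the squared residuals and
  summed. Thus a point satisfying the linearized constraint also satisfies the original one.\<close>

lemma Phi_le_linearization:
  "Phi \<phi> (resid A b v * resid A b v) \<le> Phi \<phi> (resid A b x * resid A b x)
    + (norm (lin_A \<phi> A b x *v v - lin_b \<phi> A b x))\<^sup>2 - (norm (lin_A \<phi> A b x *v x - lin_b \<phi> A b x))\<^sup>2"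
proof -
  have "Phi \<phi> (resid A b v * resid A b v) \<le> (\<Sum>i\<in>UNIV. \<phi> ((resid A b x $ i)\<^sup>2)
      + right_deriv \<phi> ((resid A b x $ i)\<^sup>2) * ((resid A b v $ i)\<^sup>2 - (resid A b x $ i)\<^sup>2))"
    unfolding Phi_def
  proof (rule sum_mono)
    fix i
    have "(resid A b v * resid A b v) $ i = (resid A b v $ i)\<^sup>2" by (simp add: power2_eq_square)
    then show "\<phi> ((resid A b v * resid A b v) $ i) \<le> \<phi> ((resid A b x $ i)\<^sup>2)
        + right_deriv \<phi> ((resid A b x $ i)\<^sup>2) * ((resid A b v $ i)\<^sup>2 - (resid A b x $ i)\<^sup>2)"
      by (simp only: loss_tangent zero_le_power2)
  qed
  also have "\<dots> = (\<Sum>i\<in>UNIV. \<phi> ((resid A b x $ i)\<^sup>2))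
      + (norm (lin_A \<phi> A b x *v v - lin_b \<phi> A b x))\<^sup>2 - (norm (lin_A \<phi> A b x *v x - lin_b \<phi> A b x))\<^sup>2"
    unfolding norm_lin_residual_sq by (simp add: sum.distrib sum_subtractf right_diff_distrib)
  finally show ?thesis by (simp add: Phi_def power2_eq_square)
qed

text \<open>The initial point has zero residual. Afterwards \<open>lin_P\<close> lands in the
  linearized feasible set, which lies inside the original one by the tangent bound.\<close>

lemma outer_run_feasible:
  fixes G :: "'q::finite \<Rightarrow> 'n set"
  assumes run: "outer_run f \<psi> G \<phi> A b \<sigma> \<tau> \<mu> \<epsilon> k x xt ut" and \<sigma>: "\<sigma> > 0" and j: "j \<le> k"
  shows "Phi \<phi> (resid A b (x j) * resid A b (x j)) \<le> \<sigma>"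
  using j
proof (induction j)
  case 0
  have "x 0 = pinv A *v b" using run by (simp add: outer_run_def)
  then have "resid A b (x 0) = 0" by (simp add: resid_def pinv_right_inverse[OF rank])
  then show ?case using \<sigma> by (simp add: Phi_def \<phi>0)
next
  case (Suc j)
  have "0 < \<epsilon> j" "\<epsilon> j \<le> lin_sigma \<phi> A b \<sigma> (x j)" "x (Suc j) = lin_P \<phi> A b \<sigma> (x j) (xt (Suc j))"
    using run Suc.prems by (auto simp: outer_run_def)
  then have "(norm (lin_A \<phi> A b (x j) *v x (Suc j) - lin_b \<phi> A b (x j)))\<^sup>2 \<le> lin_sigma \<phi> A b \<sigma> (x j)"
    using lin_P_feasible[OF rank] by (metis order_less_le_trans)
  then show ?case using Phi_le_linearization[of "x (Suc j)" "x j"] by (simp add: lin_sigma_def)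
qed

text \<open>The squared entries of \<open>upsilon\<close> are slopes of \<open>\<phi>\<close>,
  bounded by their maximum \<open>M\<close>; the Rayleigh bound handles the remaining factor
  \<open>transpose A ** A\<close>.\<close>

lemma prox_matrix_psd:
  assumes "\<beta> > 0"
  shows "\<beta> * (norm (lin_A \<phi> A b x *v v))\<^sup>2 \<le> prox_rho \<phi> A b x \<beta> * (norm v)\<^sup>2"
proof -
  define D where "D = (\<lambda>i. right_deriv \<phi> ((resid A b x $ i)\<^sup>2))"
  define M where "M = Max (range D)"
  have D: "0 \<le> D i" "D i \<le> M" for i by (simp_all add: D_def M_def loss_right_deriv_nonneg)
  have "M \<ge> 0" using D order_trans by blast
  \<comment> \<open>The formula for the linearized residual is affine, so the linear part is
    isolated as the difference of its values at \<open>v + x\<close> and \<open>x\<close>.\<close>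
  have "lin_A \<phi> A b x *v v = lin_A \<phi> A b x *v (v + x) - lin_b \<phi> A b x - (lin_A \<phi> A b x *v x - lin_b \<phi> A b x)"
    by (simp add: matrix_vector_right_distrib)
  also have "\<dots> = upsilon \<phi> A b x * (A *v v)"
    unfolding lin_residual by (simp add: resid_def matrix_vector_right_distrib algebra_simps)
  finally have "(norm (lin_A \<phi> A b x *v v))\<^sup>2 = (\<Sum>i\<in>UNIV. D i * ((A *v v) $ i)\<^sup>2)"
    by (simp only: power2_norm_mult_vec upsilon_sq D_def)
  also have "\<dots> \<le> (\<Sum>i\<in>UNIV. M * ((A *v v) $ i)\<^sup>2)"
    by (intro sum_mono mult_right_mono D) simp
  also have "\<dots> = M * ((A *v v) \<bullet> (A *v v))"
    by (simp add: inner_vec_def sum_distrib_left power2_eq_square)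
  also have "(A *v v) \<bullet> (A *v v) = v \<bullet> ((transpose A ** A) *v v)"
    by (metis inner_commute inner_transpose_mult matrix_vector_mul_assoc)
  also have "M * \<dots> \<le> M * (lambda_max (transpose A ** A) * (v \<bullet> v))"
    using \<open>M \<ge> 0\<close> by (intro mult_left_mono lambda_max_rayleigh)
      (simp_all add: matrix_transpose_mul transpose_transpose)
  finally have "\<beta> * (norm (lin_A \<phi> A b x *v v))\<^sup>2 \<le> \<beta> * (M * (lambda_max (transpose A ** A) * (v \<bullet> v)))"
    using assms by (intro mult_left_mono) auto
  then show ?thesis
    by (simp add: prox_rho_def M_def D_def power2_norm_eq_inner mult_ac)
qed

text \<open>If all slopes vanished, then \<open>\<phi>\<close> would attain its maximum at every squared residual, so
  that \<open>\<Phi>\<close> at the current residual is at least \<open>\<Phi>(b \<circ> b) > \<sigma>\<close>, contradicting \<open>\<sigma>\<^sub>k > 0\<close>.\<close>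

lemma prox_rho_pos:
  assumes "\<beta> > 0" and "\<sigma> < (\<Sum>i\<in>UNIV. \<phi> ((b $ i)\<^sup>2))" and s: "0 < lin_sigma \<phi> A b \<sigma> x"
  shows "0 < prox_rho \<phi> A b x \<beta>"
proof -
  define D where "D = (\<lambda>i. right_deriv \<phi> ((resid A b x $ i)\<^sup>2))"
  have D: "0 \<le> D i" for i by (simp add: D_def loss_right_deriv_nonneg)
  have "\<exists>i. D i \<noteq> 0"
  proof (rule ccontr)
    assume "\<not> (\<exists>i. D i \<noteq> 0)"
    then have D0: "right_deriv \<phi> ((resid A b x $ i)\<^sup>2) = 0" for i by (simp add: D_def)
    have "(\<Sum>i\<in>UNIV. \<phi> ((b $ i)\<^sup>2)) \<le> (\<Sum>i\<in>UNIV. \<phi> ((resid A b x $ i)\<^sup>2))"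
    proof (rule sum_mono)
      fix i show "\<phi> ((b $ i)\<^sup>2) \<le> \<phi> ((resid A b x $ i)\<^sup>2)"
        using loss_tangent[of "(b $ i)\<^sup>2" "(resid A b x $ i)\<^sup>2"] by (simp add: D0)
    qed
    moreover have "(norm (lin_A \<phi> A b x *v x - lin_b \<phi> A b x))\<^sup>2 = 0"
      unfolding norm_lin_residual_sq D0 by simp
    ultimately show False using s assms(2) by (simp add: lin_sigma_def Phi_def power2_eq_square)
  qed
  then obtain i where "D i > 0" using D by (metis less_eq_real_def)
  then have M: "0 < Max (range D)" by (simp add: Max_gr_iff) blast
  \<comment> \<open>A preimage of a unit vector makes the quadratic form of
    \<open>transpose A ** A\<close> equal to 1, so its largest eigenvalue is positive.\<close>
  obtain v where v: "A *v v = axis i (1::real)"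
    using rank full_rank_surjective by (metis surjD)
  have "(A *v v) \<bullet> (A *v v) = v \<bullet> ((transpose A ** A) *v v)"
    by (metis inner_commute inner_transpose_mult matrix_vector_mul_assoc)
  also have "\<dots> \<le> lambda_max (transpose A ** A) * (v \<bullet> v)"
    by (intro lambda_max_rayleigh) (simp add: matrix_transpose_mul transpose_transpose)
  finally have "0 < lambda_max (transpose A ** A) * (v \<bullet> v)" unfolding v by simp
  then have "0 < lambda_max (transpose A ** A)" by 
    (metis inner_ge_zero less_eq_real_def mult_zero_right order_less_irrefl zero_less_mult_pos2)
  then show ?thesis using M assms(1) by (simp add: prox_rho_def D_def)
qed

end

section \<open>Saddle point of the subproblem, objective gap and verification of the
  criteria\<close>

lemma crit1_if_small_element:
  assumes "\<xi> \<in> subdifferential (weighted_group_norm (weights \<psi> G x) G) xt"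
    and "v \<in> normal_cone (lin_U \<phi> A b \<sigma> x) ut"
    and "bregman f (\<xi> + transpose (lin_A \<phi> A b x) *v v) 0 \<le> \<epsilon>"
  shows "crit1 f \<psi> G \<phi> A b \<sigma> x \<epsilon> xt ut"
  unfolding crit1_def bregman_set_def
  by (rule INF_lower2[where i = "\<xi> + transpose (lin_A \<phi> A b x) *v v"]) (use assms in auto)

lemma tendsto_bregman_0:
  assumes "f differentiable (at 0)" and "(g \<longlongrightarrow> 0) F"
  shows "((\<lambda>l. bregman f (g l) 0) \<longlongrightarrow> 0) F"
proof -
  have "((\<lambda>l. f (g l)) \<longlongrightarrow> f 0) F"
    using differentiable_imp_continuous_within[OF assms(1)] assms(2)
    by (rule isCont_tendsto_compose)
  then have "((\<lambda>l. f (g l) - f 0 - grad f 0 \<bullet> (g l - 0)) \<longlongrightarrow> f 0 - f 0 - grad f 0 \<bullet> (0 - 0)) F"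
    by (intro tendsto_intros assms(2))
  then show ?thesis by (simp add: bregman_def)
qed

lemma sublevel_norm_sq_eq_cball:
  assumes "0 < s"
  shows "{u::'a::real_normed_vector. (norm u)\<^sup>2 \<le> s} = cball 0 (sqrt s)"
proof -
  have "(norm u)\<^sup>2 \<le> s \<longleftrightarrow> norm u \<le> sqrt s" for u :: 'a
    using assms real_sqrt_le_iff[of "(norm u)\<^sup>2" s] by simp
  then show ?thesis by (simp add: cball_def)
qed

text \<open>Coercivity yields a minimizer on the compact part of the feasible set where the
  objective does not exceed its value at \<open>p\<close>; feasible points outside that part are
  worse. As \<open>p\<close> is a Slater point, the minimizer has a multiplier.\<close>

lemma subproblem_saddle_point:
  fixes B :: "real^'n^'m" and G :: "'q::finite \<Rightarrow> 'n set"
  assumes w: "\<And>i. w $ i > 0" and un: "(\<Union>i. G i) = UNIV" and s: "0 < s" and p: "B *v p = d"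
  obtains xs us zs where "transpose B *v zs \<in> subdifferential (weighted_group_norm w G) xs"
    "- zs \<in> normal_cone {u. (norm u)\<^sup>2 \<le> s} us" "B *v xs - us = d"
    "\<And>v. (norm (B *v v - d))\<^sup>2 \<le> s \<Longrightarrow> weighted_group_norm w G xs \<le> weighted_group_norm w G v"
proof -
  let ?h = "weighted_group_norm w G" and ?S = "{u. (norm u)\<^sup>2 \<le> s} :: (real^'m) set"
  obtain K where K: "\<And>v. norm v \<le> K * ?h v"
    using norm_le_weighted_group_norm[OF w un] by blast
  define C where "C = {v. (norm (B *v v - d))\<^sup>2 \<le> s} \<inter> {v. ?h v \<le> ?h p}"
  have contB: "continuous_on UNIV (\<lambda>v. (norm (B *v v - d))\<^sup>2)"
    by (intro continuous_intros linear_continuous_on_compose[OF continuous_on_id]) simp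
  have "closed C" unfolding C_def
    by (intro closed_Int closed_Collect_le contB continuous_on_weighted_group_norm[OF w] continuous_on_const)
  moreover have "bounded C"
  proof -
    have "norm v \<le> \<bar>K\<bar> * ?h p" if "v \<in> C" for v
    proof -
      have "norm v \<le> \<bar>K\<bar> * ?h v"
        using K[of v] weighted_group_norm_nonneg[OF w, of G v] mult_right_mono[of K "\<bar>K\<bar>" "?h v"] by linarith
      also have "\<dots> \<le> \<bar>K\<bar> * ?h p" using that by (intro mult_left_mono) (auto simp: C_def)
      finally show ?thesis .
    qed
    then show ?thesis by (auto simp: bounded_iff)
  qed
  ultimately have "compact C" by (simp add: compact_eq_bounded_closed)
  moreover have "p \<in> C" using p s by (simp add: C_def)
  ultimately obtain xs where xs: "xs \<in> C" "\<And>v. v \<in> C \<Longrightarrow> ?h xs \<le> ?h v"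
    using continuous_attains_inf[OF _ _ continuous_on_weighted_group_norm[OF w], of C G] by blast
  have opt: "?h xs \<le> ?h v" if "(norm (B *v v - d))\<^sup>2 \<le> s" for v
    using xs(2)[of v] xs(2)[OF \<open>p \<in> C\<close>] that by (cases "?h v \<le> ?h p") (auto simp: C_def)
  have "convex ?S" "0 \<in> interior ?S" using s by (simp_all add: sublevel_norm_sq_eq_cball)
  moreover have "?h xs \<le> ?h y" if "u \<in> ?S" "B *v y - u = d" for y u
  proof (rule opt)
    have "B *v y - d = u" using that(2) by (simp add: algebra_simps)
    then show "(norm (B *v y - d))\<^sup>2 \<le> s" using that(1) by simp
  qed
  moreover have "B *v xs - d \<in> ?S" "B *v xs - (B *v xs - d) = d" using xs(1) by (simp_all add: C_def)
  ultimately obtain zs where "transpose B *v zs \<in> subdifferential ?h xs" "- zs \<in> normal_cone ?S (B *v xs - d)"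
    using convex_lagrange_multiplier[OF convex_on_weighted_group_norm[OF w] _ _ p] by blast
  then show thesis using opt by (intro that[of zs xs "B *v xs - d"]) auto
qed

lemma normal_cone_base: "v \<in> normal_cone S u \<Longrightarrow> u \<in> S"
  by (simp add: normal_cone_def split: if_splits)

text \<open>The subgradient inequality towards \<open>xs\<close>, with
  \<open>transpose B *v v\<close> added and subtracted. The normal cone inequality disposes of the
  product of \<open>v\<close> with \<open>us - u\<close>, so only the optimality defect and the
  residual remain.\<close>

lemma objective_gap_le:
  fixes B :: "real^'n^'m"
  assumes \<xi>: "\<xi> \<in> subdifferential h x" and v: "v \<in> normal_cone S u"
    and us: "us \<in> S" "B *v xs - us = d"
  shows "h x \<le> h xs + norm (\<xi> + transpose B *v v) * norm (x - xs) + norm v * norm (B *v x - d - u)"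
proof -
  have "h x + \<xi> \<bullet> (xs - x) \<le> h xs" using \<xi> by (simp add: subdifferential_def)
  moreover have "v \<bullet> (us - u) \<le> 0" using v us(1) by (auto simp: normal_cone_def split: if_splits)
  moreover have "\<xi> \<bullet> (x - xs) = (\<xi> + transpose B *v v) \<bullet> (x - xs) - v \<bullet> (B *v (x - xs))"
    by (simp only: inner_add_left inner_transpose_mult)
  moreover have "B *v (x - xs) = (B *v x - d - u) - (us - u)"
    using us(2) by (simp add: matrix_vector_mult_diff_distrib algebra_simps)
  then have "v \<bullet> (B *v (x - xs)) = v \<bullet> (B *v x - d - u) - v \<bullet> (us - u)"
    by (simp only: inner_diff_right)
  moreover have "\<xi> \<bullet> (xs - x) = - (\<xi> \<bullet> (x - xs))" by (simp add: inner_diff_right)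
  moreover have "(\<xi> + transpose B *v v) \<bullet> (x - xs) \<le> norm (\<xi> + transpose B *v v) * norm (x - xs)"
    by (rule norm_cauchy_schwarz)
  moreover have "- (v \<bullet> (B *v x - d - u)) \<le> norm v * norm (B *v x - d - u)"
    using Cauchy_Schwarz_ineq2[of v "B *v x - d - u"] by linarith
  ultimately show ?thesis by linarith
qed

theorem theorem1:
  fixes A :: "real^'n^'m" and b :: "real^'m" and \<sigma> :: real
    and G :: "'q::finite \<Rightarrow> 'n set"
    and \<psi> \<phi> :: "real \<Rightarrow> real"
    and f :: "real^'n \<Rightarrow> real"
    and \<tau> \<mu> \<epsilon> :: "nat \<Rightarrow> real" and k :: nat
    and x xt :: "nat \<Rightarrow> real^'n" and ut :: "nat \<Rightarrow> real^'m"
    and \<beta> r :: real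
    and X :: "nat \<Rightarrow> real^'n" and U Z :: "nat \<Rightarrow> real^'m"
  assumes "partition_on UNIV (range G)" and "inj G"
    and "\<forall>t\<ge>0. \<psi> t \<ge> 0" and "continuous_on {0..} \<psi>" and "strictly_concave_on {0..} \<psi>"
    and "\<psi> 0 = 0" and "filterlim \<psi> at_top at_top"
    and "\<forall>t>0. \<psi> differentiable (at t) \<and> deriv \<psi> t > 0"
    and "\<exists>L>0. (deriv \<psi> \<longlongrightarrow> L) (at_right 0)"
    and "\<forall>t\<ge>0. \<phi> t \<ge> 0" and "continuous_on {0..} \<phi>" and "concave_on {0..} \<phi>"
    and "\<phi> 0 = 0"
    and "\<forall>t>0. \<phi> differentiable (at t) \<and> deriv \<phi> t \<ge> 0"
    and "\<exists>L>0. (deriv \<phi> \<longlongrightarrow> L) (at_right 0)"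
    and "rank A = CARD('m)" and "0 < \<sigma>" and "\<sigma> < (\<Sum>i\<in>UNIV. \<phi> ((b $ i)\<^sup>2))"
    and "\<exists>v. (\<Sum>i\<in>UNIV. \<phi> (((A *v v - b) $ i)\<^sup>2)) = \<sigma>"
    and "\<forall>j\<in>{1..CARD('m)}. ereal \<sigma> \<noteq> ereal (real j) * (SUP t\<in>{0..}. ereal (\<phi> t))"
    and "\<forall>v. f differentiable (at v)" and "continuous_on UNIV (grad f)"
    and "strictly_convex_on UNIV f"
    and "\<forall>j. \<tau> j > 0" and "\<tau> \<longlonglongrightarrow> 0"
    and "\<forall>j. \<mu> j > 0" and "summable \<mu>"
    and "outer_run f \<psi> G \<phi> A b \<sigma> \<tau> \<mu> \<epsilon> k x xt ut"
    and "\<beta> > 0" and "0 < r" and "r < (1 + sqrt 5) / 2"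
    and "prox_admm \<psi> G \<phi> A b \<sigma> (x k) \<beta> r X U Z"
  shows "\<forall>\<^sub>F l in sequentially.
           crit1 f \<psi> G \<phi> A b \<sigma> (x k) (\<epsilon> k) (X l) (U l) \<and>
           crit2 \<phi> A b (x k) (\<epsilon> k) (X l) (U l) \<and>
           crit3 \<psi> G \<phi> A b \<sigma> (x k) (\<mu> k) (X l)"
proof -
  define B where "B = lin_A \<phi> A b (x k)"
  define d where "d = lin_b \<phi> A b (x k)"
  define s where "s = lin_sigma \<phi> A b \<sigma> (x k)"
  define S where "S = lin_U \<phi> A b \<sigma> (x k)"
  define w where "w = weights \<psi> G (x k)"
  define h where "h = weighted_group_norm w G"
  define \<rho> where "\<rho> = prox_rho \<phi> A b (x k) \<beta>"
  define p where "p = pinv A *v b"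
  note \<phi> = assms(11,12,13,14,15)
  note rank = assms(16) and run = assms(28) and admm = assms(32) and pos = assms(29,30,31)
  have un: "(\<Union>i. G i) = UNIV" using assms(1) by (simp add: partition_on_def)
  have w: "w $ i > 0" for i
    unfolding w_def by (rule weights_pos[OF assms(4,6,8,9)])
  have \<epsilon>: "0 < \<epsilon> k" "\<epsilon> k \<le> s" using run by (auto simp: outer_run_def s_def)
  then have s: "0 < s" by linarith
  have S_eq: "S = {u. (norm u)\<^sup>2 \<le> s}" by (simp add: S_def lin_U_def s_def)
  have "B *v p - d = 0"
    unfolding B_def d_def p_def lin_residual by (simp add: resid_def pinv_right_inverse[OF rank])
  then have p: "B *v p = d" by simp
  obtain xs us zs where saddle: "transpose B *v zs \<in> subdifferential h xs" "- zs \<in> normal_cone S us"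
      "B *v xs - us = d"
    and opt: "\<And>v. (norm (B *v v - d))\<^sup>2 \<le> s \<Longrightarrow> h xs \<le> h v"
    by (rule subproblem_saddle_point[OF w un s p, folded h_def S_eq]) (rule that)
  have us: "us \<in> S" using saddle(2) by (rule normal_cone_base)
  have S: "convex S" "S \<noteq> {}"
    using us s by (auto simp: S_eq sublevel_norm_sq_eq_cball)
  have psd: "\<beta> * (norm (B *v v))\<^sup>2 \<le> \<rho> * (norm v)\<^sup>2" for v
    unfolding B_def \<rho>_def by (rule prox_matrix_psd[OF \<phi> rank pos(1)])
  have \<rho>: "\<rho> > 0"
    unfolding \<rho>_def using s by (intro prox_rho_pos[OF \<phi> rank pos(1) assms(18)]) (simp add: s_def)

  define R where "R l = B *v X l - d - U l" for l
  \<comment> \<open>Indices are shifted: \<open>v l\<close> and \<open>\<xi> l\<close> belong to the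
    step from \<open>l\<close> to \<open>Suc l\<close>, hence to the points \<open>U (Suc l)\<close>
    and \<open>X (Suc l)\<close>.\<close>
  define v where "v l = - Z l + \<beta> *\<^sub>R R (Suc l)" for l
  define \<xi> where "\<xi> l = transpose B *v (Z l - \<beta> *\<^sub>R (R (Suc l) + (U (Suc l) - U l)))
      - (\<rho> *\<^sub>R (X (Suc l) - X l) - \<beta> *\<^sub>R (transpose B *v (B *v (X (Suc l) - X l))))" for l
  have z_step: "Z (Suc l) = Z l - (r * \<beta>) *\<^sub>R R (Suc l)" for l
    using admm by (simp add: prox_admm_def R_def B_def d_def)
  have u_opt: "v l \<in> normal_cone S (U (Suc l))" for l
    using prox_u_step_normal[of \<phi> A b \<sigma> "x k" \<psi> G \<beta> "X (Suc l)" "Z l" "U (Suc l)"] admm S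
    by (simp add: prox_admm_def v_def R_def B_def d_def S_def)
  then have U_in: "U (Suc l) \<in> S" for l by (rule normal_cone_base)
  \<comment> \<open>Stated only from the second \<open>x\<close>-step on: \<open>U 0\<close> may lie
    outside \<open>S\<close>, in which case the first \<open>x\<close>-step carries no
    information.\<close>
  have x_opt: "\<xi> (Suc l) \<in> subdifferential h (X (Suc (Suc l)))" for l
  proof -
    have r: "B *v X (Suc (Suc l)) - U (Suc l) - d = R (Suc (Suc l)) + (U (Suc (Suc l)) - U (Suc l))"
      by (simp add: R_def)
    note min = admm[unfolded prox_admm_def, THEN spec, of "Suc l", THEN conjunct1]
    show ?thesis
      using prox_x_step_subgradient[OF convex_on_weighted_group_norm[OF w[unfolded w_def]]
          U_in[of l, unfolded S_def] min]
      unfolding \<xi>_def h_def w_def r[symmetric] B_def d_def \<rho>_def .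
  qed
  \<comment> \<open>The initial condition for the asymptotics of the run started at index 1: the
    first \<open>u\<close>-step supplies the normal vector, rewritten by the multiplier
    update.\<close>
  have v_0: "- Z (Suc 0) + ((1 - r) * \<beta>) *\<^sub>R R (Suc 0) = v 0"
    by (simp add: v_def z_step algebra_simps)
  note asym = prox_admm_asymptotics[OF pos(1) \<rho> pos(2,3) psd saddle,
      of "\<lambda>l. Z (Suc l)" "\<lambda>l. X (Suc l)" "\<lambda>l. U (Suc l)" "v 0",
      folded R_def, OF z_step x_opt[unfolded \<xi>_def] u_opt[of 0] v_0[symmetric] u_opt[unfolded v_def]]
  have R0: "(\<lambda>l. R (Suc l)) \<longlonglongrightarrow> 0" and dU: "(\<lambda>l. U (Suc (Suc l)) - U (Suc l)) \<longlonglongrightarrow> 0"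
    and dX: "(\<lambda>l. X (Suc (Suc l)) - X (Suc l)) \<longlonglongrightarrow> 0"
    and bd: "bounded (range (\<lambda>l. X (Suc l)))" "bounded (range (\<lambda>l. Z (Suc l)))"
    using asym by blast+
  \<comment> \<open>The element for the first criterion at index \<open>Suc (Suc l)\<close>. The
    multiplier and the residual cancel between its two summands, which leaves only
    increments.\<close>
  define \<eta> where "\<eta> l = \<xi> (Suc l) + transpose B *v v (Suc l)" for l
  have \<eta>_eq: "\<eta> l = - (\<beta> *\<^sub>R (transpose B *v (U (Suc (Suc l)) - U (Suc l))))
      - (\<rho> *\<^sub>R (X (Suc (Suc l)) - X (Suc l)) - \<beta> *\<^sub>R (transpose B *v (B *v (X (Suc (Suc l)) - X (Suc l)))))" for l
    by (simp add: \<eta>_def \<xi>_def v_def matrix_vector_right_distrib matrix_vector_mult_diff_distrib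
        matrix_vector_mult_scaleR algebra_simps del: transpose_matrix_vector)
  have mult_0: "(\<lambda>l. M *v g l) \<longlonglongrightarrow> 0" if "g \<longlonglongrightarrow> 0" for M :: "real^'a^'b" and g
    using bounded_linear.tendsto[OF matrix_vector_mul_bounded_linear[of M] that] by simp
  have "\<eta> \<longlonglongrightarrow> - (\<beta> *\<^sub>R 0) - (\<rho> *\<^sub>R 0 - \<beta> *\<^sub>R 0)"
    unfolding \<eta>_eq[abs_def] by (intro tendsto_intros mult_0 dU dX)
  then have \<eta>0: "\<eta> \<longlonglongrightarrow> 0" by simp
  have R0': "(\<lambda>l. R (Suc (Suc l))) \<longlonglongrightarrow> 0" using R0 by (rule LIMSEQ_Suc)
  have nR0: "(\<lambda>l. norm (R (Suc (Suc l)))) \<longlonglongrightarrow> 0" using R0' by (rule tendsto_norm_zero)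
  obtain KX where KX: "\<And>l. norm (X (Suc l)) \<le> KX" using bd(1) by (auto simp: bounded_iff)
  obtain KZ where KZ: "\<And>l. norm (Z (Suc l)) \<le> KZ" using bd(2) by (auto simp: bounded_iff)
  \<comment> \<open>The first two terms bound the objective gap at \<open>X (Suc (Suc l))\<close>,
    with the norm of \<open>v (Suc l)\<close> estimated through \<open>KZ\<close> and the residual.
    The third is the cost of applying \<open>lin_P\<close>.\<close>
  define gap where "gap l = norm (\<eta> l) * (KX + norm xs)
      + (KZ + \<beta> * norm (R (Suc (Suc l)))) * norm (R (Suc (Suc l)))
      + norm (R (Suc (Suc l))) / sqrt s * h (pinv A *v b)" for l
  have "gap \<longlonglongrightarrow> 0 * (KX + norm xs) + (KZ + \<beta> * 0) * 0 + 0 / sqrt s * h (pinv A *v b)"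
    unfolding gap_def[abs_def] using s by (intro tendsto_intros nR0 tendsto_norm_zero[OF \<eta>0]) simp
  then have "gap \<longlonglongrightarrow> 0" by simp
  then have ev3: "\<forall>\<^sub>F l in sequentially. gap l < \<mu> k"
    using assms(26) by (intro order_tendstoD(2)) auto
  have ev2: "\<forall>\<^sub>F l in sequentially. norm (R (Suc (Suc l))) < \<epsilon> k"
    using nR0 \<epsilon>(1) by (intro order_tendstoD(2))
  have "(\<lambda>l. bregman f (\<eta> l) 0) \<longlonglongrightarrow> 0"
    using assms(21) \<eta>0 by (intro tendsto_bregman_0) auto
  then have ev1: "\<forall>\<^sub>F l in sequentially. bregman f (\<eta> l) 0 < \<epsilon> k"
    using \<epsilon>(1) by (intro order_tendstoD(2))
  \<comment> \<open>The bound \<open>Phi \<le> \<sigma>\<close> at \<open>x k\<close> says precisely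
    that \<open>x k\<close> satisfies the linearized constraint, so the optimal value of the
    subproblem is at most \<open>h (x k)\<close>.\<close>
  have h_xs: "h xs \<le> h (x k)"
    using outer_run_feasible[OF \<phi> rank run assms(17), of k]
    by (intro opt) (simp add: s_def lin_sigma_def B_def d_def)
  have h_P: "h (lin_P \<phi> A b \<sigma> (x k) (X (Suc (Suc l)))) \<le> h (x k) + gap l" for l
  proof -
    have "h (lin_P \<phi> A b \<sigma> (x k) (X (Suc (Suc l)))) \<le> h (X (Suc (Suc l)))
        + norm (R (Suc (Suc l))) / sqrt s * h (pinv A *v b)"
      using lin_P_weighted_group_norm_le[OF w, of \<phi> A b \<sigma> "x k" "U (Suc (Suc l))" G "X (Suc (Suc l))"]
        s U_in[of "Suc l"]
      by (simp add: h_def s_def S_def R_def B_def d_def)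
    moreover have "h (X (Suc (Suc l))) \<le> h xs + norm (\<eta> l) * norm (X (Suc (Suc l)) - xs)
        + norm (v (Suc l)) * norm (R (Suc (Suc l)))"
      using objective_gap_le[OF x_opt u_opt us saddle(3)] by (simp only: \<eta>_def R_def)
    moreover have "norm (\<eta> l) * norm (X (Suc (Suc l)) - xs) \<le> norm (\<eta> l) * (KX + norm xs)"
      using KX[of "Suc l"] norm_triangle_ineq4[of "X (Suc (Suc l))" xs] by (intro mult_left_mono) auto
    moreover have "norm (v (Suc l)) * norm (R (Suc (Suc l)))
        \<le> (KZ + \<beta> * norm (R (Suc (Suc l)))) * norm (R (Suc (Suc l)))"
    proof (rule mult_right_mono)
      have "norm (v (Suc l)) \<le> norm (- Z (Suc l)) + norm (\<beta> *\<^sub>R R (Suc (Suc l)))"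
        unfolding v_def by (rule norm_triangle_ineq)
      then show "norm (v (Suc l)) \<le> KZ + \<beta> * norm (R (Suc (Suc l)))"
        using KZ[of l] pos(1) by simp
    qed simp
    ultimately show ?thesis using h_xs by (simp add: gap_def)
  qed
  have "\<forall>\<^sub>F l in sequentially.
      crit1 f \<psi> G \<phi> A b \<sigma> (x k) (\<epsilon> k) (X (Suc (Suc l))) (U (Suc (Suc l))) \<and>
      crit2 \<phi> A b (x k) (\<epsilon> k) (X (Suc (Suc l))) (U (Suc (Suc l))) \<and>
      crit3 \<psi> G \<phi> A b \<sigma> (x k) (\<mu> k) (X (Suc (Suc l)))"
    using ev1 ev2 ev3
  proof eventually_elim
    case (elim l)
    have "crit1 f \<psi> G \<phi> A b \<sigma> (x k) (\<epsilon> k) (X (Suc (Suc l))) (U (Suc (Suc l)))"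
      using x_opt[of l] u_opt[of "Suc l"] elim(1) unfolding \<eta>_def h_def w_def S_def B_def
      by (intro crit1_if_small_element) auto
    moreover have "crit2 \<phi> A b (x k) (\<epsilon> k) (X (Suc (Suc l))) (U (Suc (Suc l)))"
      using elim(2) by (simp add: crit2_def R_def B_def d_def)
    moreover have "crit3 \<psi> G \<phi> A b \<sigma> (x k) (\<mu> k) (X (Suc (Suc l)))"
      using h_P[of l] elim(3) by (simp add: crit3_def h_def w_def)
    ultimately show ?case by blast
  qed
  then show ?thesis
    by - (rule eventually_sequentially_seg[where k = 2, THEN iffD1], simp)
qed

end
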